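(* Let $\mathbb{K}$ be a field of characteristic zero, let $R$ be a $\mathbb{K}$-algebra, and let $f\in R$ be a nonzero element. Suppose that $R$ has Bernstein-Sato polynomials and that $D_{R|\mathbb{K}}$ is a Noetherian ring. Then, for every ideal $\mathfrak{a}\subseteq R$ and every $i$, the local cohomology module $H^i_{\mathfrak{a}}(R)$ is a finitely generated $D_{R|\mathbb{K}}$-module, and its set of associated primes $\operatorname{Ass}_R(H^i_{\mathfrak{a}}(R))$ is finite.
   Context: $R$ is a commutative $\mathbb{K}$-algebra. Rings of differential operators: $D^0_{R|\mathbb{K}}=\operatorname{Hom}_R(R,R)\subseteq\operatorname{End}_{\mathbb{K}}(R)$, $D^i_{R|\mathbb{K}}=\{\delta\in\operatorname{End}_{\mathbb{K}}(R)\mid\delta\circ\mu-\mu\circ\delta\in D^{i-1}_{R|\mathbb{K}}\text{ for all }\mu\in D^0_{R|\mathbb{K}}\}$, $D_{R|\mathbb{K}}=\bigcup_iD^i_{R|\mathbb{K}}$. Noetherian ring means left and right Noetherian. $D$-modules are left modules. An element $h\in R$ admits a Bernstein-Sato polynomial if there exist $\delta(s)\in D_{R|\mathbb{K}}[s]$ ($s$ a central indeterminate) and a nonzero $b(s)\in\mathbb{K}[s]$ with $\delta(s)h^{s+1}=b(s)h^s$ for all $s\in\mathbb{N}$. $R$ has Bernstein-Sato polynomials if every element of $R$ admits one. Local cohomology: for generators $f_1,\ldots,f_\ell$ of $\mathfrak{a}$, $H^i_{\mathfrak{a}}(R)$ is the $i$-th cohomology of the Čech complex $0\to R\to\bigoplus_iR_{f_i}\to\bigoplus_{i,j}R_{f_if_j}\to\cdots\to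 R_{f_1\cdots f_\ell}\to0$. Every localization $W^{-1}R$ is a left $D_{R|\mathbb{K}}$-module: for $\delta\in D^t_{R|\mathbb{K}}$, $g\in W$, put $\delta^{(0),g}=\delta$, $\delta^{(j),g}=\delta^{(j-1),g}\circ g-g\circ\delta^{(j-1),g}$, and $\delta\cdot\frac{r}{g}=\sum_{j=0}^t(-1)^j\frac{\delta^{(j),g}(r)}{g^{j+1}}$. The Čech complex is a complex of $D_{R|\mathbb{K}}$-modules, so $H^i_{\mathfrak{a}}(R)$ is a left $D_{R|\mathbb{K}}$-module. *)

theory Defs
  imports "HOL-Algebra.Algebra" "HOL-Algebra.Algebraic_Closure_Type"
    "HOL-Computational_Algebra.Polynomial"
begin

section \<open>Algebras and differential operators\<close>

text \<open>A commutative algebra over a field, given by the scalar multiplication on a commutative ring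
  type. The associated record is \<^const>\<open>ring_of_type_algebra\<close>.\<close>

definition k_algebra :: "('k::field \<Rightarrow> 'r::comm_ring_1 \<Rightarrow> 'r) \<Rightarrow> bool" where
  "k_algebra scale \<longleftrightarrow>
     vector_space scale \<and> (\<forall>c x y. scale c (x * y) = scale c x * y)"

definition R_endos :: "('r::comm_ring_1 \<Rightarrow> 'r) set" where
  "R_endos = {\<mu>. Modules.module_hom (*) (*) \<mu>}"

primrec diffop_le ::
  "('k::field \<Rightarrow> 'r::comm_ring_1 \<Rightarrow> 'r) \<Rightarrow> nat \<Rightarrow> ('r \<Rightarrow> 'r) set" where
  "diffop_le scale 0 = R_endos"
| "diffop_le scale (Suc i) =
     {\<delta>. Vector_Spaces.linear scale scale \<delta> \<and>
         (\<forall>\<mu>\<in>R_endos. (\<lambda>x. \<delta> (\<mu> x) - \<mu> (\<delta> x)) \<in> diffop_le scale i)}"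

definition diffop_ring ::
  "('k::field \<Rightarrow> 'r::comm_ring_1 \<Rightarrow> 'r) \<Rightarrow> ('r \<Rightarrow> 'r) ring" where
  "diffop_ring scale =
     \<lparr>carrier = (\<Union>i. diffop_le scale i), monoid.mult = (\<lambda>\<delta> \<eta>. \<delta> \<circ> \<eta>), one = id,
      ring.zero = (\<lambda>_. 0), add = (\<lambda>\<delta> \<eta> x. \<delta> x + \<eta> x)\<rparr>"

lemma R_endos_iff:
  "\<mu> \<in> R_endos \<longleftrightarrow> (\<forall>x y. \<mu> (x + y) = \<mu> x + \<mu> y) \<and> (\<forall>r x. \<mu> (r * x) = r * \<mu> x)"
  by (simp add: R_endos_def module_hom_def module_hom_axioms_def Modules.module_def algebra_simps)

lemma R_endos_eq: "\<mu> \<in> R_endos \<Longrightarrow> \<mu> x = x * \<mu> 1"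
  by (metis R_endos_iff mult.right_neutral)

lemma mult_in_R_endos: "(\<lambda>x. a * x) \<in> R_endos"
  by (simp add: R_endos_iff algebra_simps)

lemma lin_iff:
  assumes "k_algebra scale"
  shows "Vector_Spaces.linear scale scale \<delta> \<longleftrightarrow>
    (\<forall>x y. \<delta> (x + y) = \<delta> x + \<delta> y) \<and> (\<forall>c x. \<delta> (scale c x) = scale c (\<delta> x))"
  using assms
  by (auto simp: k_algebra_def linear_iff_module_hom module_hom_def module_hom_axioms_def
      module_iff_vector_space)

lemma scale_eq:
  assumes "k_algebra scale" shows "scale c x = scale c 1 * x"
  using assms unfolding k_algebra_def by (metis mult_1)

lemma diffop_le_linear:
  assumes "k_algebra scale" "\<delta> \<in> diffop_le scale i"
  shows "\<delta> (x + y) = \<delta> x + \<delta> y" "\<delta> (scale c x) = scale c (\<delta> x)"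
proof -
  have "(\<forall>x y. \<delta> (x + y) = \<delta> x + \<delta> y) \<and> (\<forall>c x. \<delta> (scale c x) = scale c (\<delta> x))"
  proof (cases i)
    case 0
    then have \<delta>: "\<delta> (x + y) = \<delta> x + \<delta> y" "\<delta> (r * x) = r * \<delta> x" for x y r
      using assms(2) by (simp_all add: R_endos_iff)
    have "\<delta> (scale c x) = scale c (\<delta> x)" for c x
      unfolding scale_eq[OF assms(1), of c x] scale_eq[OF assms(1), of c "\<delta> x"] by (rule \<delta>(2))
    with \<delta>(1) show ?thesis by blast
  next
    case (Suc j)
    then have "Vector_Spaces.linear scale scale \<delta>" using assms(2) by simp
    then show ?thesis by (rule iffD1[OF lin_iff[OF assms(1)]])
  qed
  then show "\<delta> (x + y) = \<delta> x + \<delta> y" "\<delta> (scale c x) = scale c (\<delta> x)" by blast+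
qed

lemma diffop_le_Suc_iff:
  assumes "k_algebra scale"
  shows "\<delta> \<in> diffop_le scale (Suc i) \<longleftrightarrow>
    (\<forall>x y. \<delta> (x + y) = \<delta> x + \<delta> y) \<and> (\<forall>c x. \<delta> (scale c x) = scale c (\<delta> x)) \<and>
    (\<forall>\<mu>\<in>R_endos. (\<lambda>x. \<delta> (\<mu> x) - \<mu> (\<delta> x)) \<in> diffop_le scale i)"
  using lin_iff[OF assms] by auto

lemma scale_algebra:
  assumes "k_algebra scale"
  shows "scale c (x + y) = scale c x + scale c y" "scale c (- x) = - scale c x"
    "scale c (x - y) = scale c x - scale c y" "scale c 0 = 0"
  unfolding scale_eq[OF assms, of c "x + y"] scale_eq[OF assms, of c x] scale_eq[OF assms, of c y]
    scale_eq[OF assms, of c "- x"] scale_eq[OF assms, of c "x - y"] scale_eq[OF assms, of c 0]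
  by (simp_all add: algebra_simps)

lemma diffop_le_zero:
  fixes scale :: "'k::field \<Rightarrow> 'r::comm_ring_1 \<Rightarrow> 'r"
  assumes "k_algebra scale" shows "(\<lambda>_. 0) \<in> diffop_le scale i"
proof (induction i)
  case (Suc i)
  have z: "\<mu> 0 = (0::'r)" if "\<mu> \<in> R_endos" for \<mu> using that by (metis R_endos_eq mult_zero_left)
  then have "(\<lambda>x::'r. 0 - \<mu> 0) = (\<lambda>_. (0::'r))" if "\<mu> \<in> R_endos" for \<mu> using z[OF that] by simp
  then show ?case
    using Suc unfolding diffop_le_Suc_iff[OF assms] by (simp add: scale_algebra[OF assms])
qed (simp add: R_endos_iff)

lemma diffop_le_add:
  assumes "k_algebra scale" "\<delta> \<in> diffop_le scale i" "\<eta> \<in> diffop_le scale i"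
  shows "(\<lambda>x. \<delta> x + \<eta> x) \<in> diffop_le scale i"
  using assms(2,3)
proof (induction i arbitrary: \<delta> \<eta>)
  case 0
  then show ?case by (simp add: R_endos_iff algebra_simps)
next
  case (Suc i)
  have "(\<lambda>x. \<delta> (\<mu> x) + \<eta> (\<mu> x) - \<mu> (\<delta> x + \<eta> x)) \<in> diffop_le scale i" if "\<mu> \<in> R_endos" for \<mu>
  proof -
    have "(\<lambda>x. \<delta> (\<mu> x) + \<eta> (\<mu> x) - \<mu> (\<delta> x + \<eta> x))
        = (\<lambda>x. (\<delta> (\<mu> x) - \<mu> (\<delta> x)) + (\<eta> (\<mu> x) - \<mu> (\<eta> x)))"
      using that by (auto simp: R_endos_iff)
    then show ?thesis
      using Suc.IH Suc.prems that unfolding diffop_le_Suc_iff[OF assms(1)] by simp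
  qed
  then show ?case
    using Suc.prems unfolding diffop_le_Suc_iff[OF assms(1)]
    by (simp add: scale_algebra[OF assms(1)])
qed

lemma diffop_le_uminus:
  assumes "k_algebra scale" "\<delta> \<in> diffop_le scale i"
  shows "(\<lambda>x. - \<delta> x) \<in> diffop_le scale i"
  using assms(2)
proof (induction i arbitrary: \<delta>)
  case 0
  then show ?case by (simp add: R_endos_iff)
next
  case (Suc i)
  have "(\<lambda>x. - \<delta> (\<mu> x) - \<mu> (- \<delta> x)) \<in> diffop_le scale i" if "\<mu> \<in> R_endos" for \<mu>
  proof -
    have "\<mu> (- x) = - \<mu> x" for x using R_endos_eq[OF that] by (metis mult_minus_left)
    then have "(\<lambda>x. - \<delta> (\<mu> x) - \<mu> (- \<delta> x)) = (\<lambda>x. - (\<delta> (\<mu> x) - \<mu> (\<delta> x)))" by auto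
    moreover have "(\<lambda>x. \<delta> (\<mu> x) - \<mu> (\<delta> x)) \<in> diffop_le scale i"
      using Suc.prems that unfolding diffop_le_Suc_iff[OF assms(1)] by blast
    ultimately show ?thesis using Suc.IH by metis
  qed
  then show ?case
    using Suc.prems unfolding diffop_le_Suc_iff[OF assms(1)]
    by (simp add: scale_algebra[OF assms(1)])
qed

lemma R_endos_commute: "\<mu> \<in> R_endos \<Longrightarrow> \<nu> \<in> R_endos \<Longrightarrow> \<mu> (\<nu> x) = \<nu> (\<mu> x)"
proof -
  assume \<mu>: "\<mu> \<in> R_endos" and \<nu>: "\<nu> \<in> R_endos"
  have 1: "\<mu> (\<nu> x) = x * \<nu> 1 * \<mu> 1"
    using R_endos_eq[OF \<mu>, of "\<nu> x"] R_endos_eq[OF \<nu>, of x] by (rule trans[OF _ arg_cong[where f = "\<lambda>y. y * _"]])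
  have 2: "\<nu> (\<mu> x) = x * \<mu> 1 * \<nu> 1"
    using R_endos_eq[OF \<nu>, of "\<mu> x"] R_endos_eq[OF \<mu>, of x] by (rule trans[OF _ arg_cong[where f = "\<lambda>y. y * _"]])
  show ?thesis unfolding 1 2 by (simp only: ac_simps)
qed

lemma diffop_le_mono1:
  assumes "k_algebra scale" "\<delta> \<in> diffop_le scale i"
  shows "\<delta> \<in> diffop_le scale (Suc i)"
  using assms(2)
proof (induction i arbitrary: \<delta>)
  case 0
  have "(\<lambda>x. \<delta> (\<mu> x) - \<mu> (\<delta> x)) = (\<lambda>_. 0)" if "\<mu> \<in> R_endos" for \<mu>
    using 0 R_endos_commute[of \<delta> \<mu>] that by auto
  then show ?case
    using diffop_le_linear[OF assms(1) 0] diffop_le_zero[OF assms(1), of 0]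
    unfolding diffop_le_Suc_iff[OF assms(1)] by simp
next
  case (Suc i)
  have "\<forall>\<mu>\<in>R_endos. (\<lambda>x. \<delta> (\<mu> x) - \<mu> (\<delta> x)) \<in> diffop_le scale i"
    using Suc.prems unfolding diffop_le_Suc_iff[OF assms(1)] by blast
  then have "\<forall>\<mu>\<in>R_endos. (\<lambda>x. \<delta> (\<mu> x) - \<mu> (\<delta> x)) \<in> diffop_le scale (Suc i)"
    using Suc.IH by blast
  then show ?case
    by (intro iffD2[OF diffop_le_Suc_iff[OF assms(1)]] conjI allI
        diffop_le_linear[OF assms(1) Suc.prems])
qed

lemma diffop_le_mono:
  assumes "k_algebra scale" "\<delta> \<in> diffop_le scale i" "i \<le> j"
  shows "\<delta> \<in> diffop_le scale j"
proof -
  have "\<delta> \<in> diffop_le scale (i + k)" for k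
  proof (induction k)
    case 0
    show ?case using assms(2) by (simp only: add_0_right)
  next
    case (Suc k)
    show ?case unfolding add_Suc_right by (rule diffop_le_mono1[OF assms(1) Suc.IH])
  qed
  from this[of "j - i"] show ?thesis unfolding le_add_diff_inverse[OF assms(3)] .
qed

lemma diffop_le_comp:
  assumes "k_algebra scale" "\<delta> \<in> diffop_le scale i" "\<eta> \<in> diffop_le scale j"
  shows "(\<lambda>x. \<delta> (\<eta> x)) \<in> diffop_le scale (i + j)"
  using assms(2,3)
proof (induction "i + j" arbitrary: i j \<delta> \<eta>)
  case 0
  then show ?case by (simp add: R_endos_iff)
next
  case (Suc n)
  note lin = diffop_le_linear[OF assms(1) Suc.prems(1)] diffop_le_linear[OF assms(1) Suc.prems(2)]
  have "(\<lambda>x. \<delta> (\<eta> (\<mu> x)) - \<mu> (\<delta> (\<eta> x))) \<in> diffop_le scale n" if \<mu>: "\<mu> \<in> R_endos" for \<mu>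
  proof -
    have "(\<lambda>x. \<delta> (\<eta> (\<mu> x) - \<mu> (\<eta> x))) \<in> diffop_le scale n"
    proof (cases j)
      case 0
      then have "\<eta> (\<mu> x) - \<mu> (\<eta> x) = 0" for x using Suc.prems(2) R_endos_commute[of \<eta> \<mu>] \<mu> by simp
      moreover have "\<delta> 0 = 0" using lin(1)[of 0 0] by simp
      ultimately show ?thesis using diffop_le_zero[OF assms(1)] by simp
    next
      case (Suc j')
      then have *: "(\<lambda>x. \<eta> (\<mu> x) - \<mu> (\<eta> x)) \<in> diffop_le scale j'"
        using Suc.prems(2) \<mu> by simp
      have "n = i + j'" using Suc.hyps(2) Suc by simp
      show ?thesis unfolding \<open>n = i + j'\<close> by (rule Suc.hyps(1)[OF \<open>n = i + j'\<close> Suc.prems(1) *])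
    qed
    moreover have "(\<lambda>x. \<delta> (\<mu> (\<eta> x)) - \<mu> (\<delta> (\<eta> x))) \<in> diffop_le scale n"
    proof (cases i)
      case 0
      then have "\<delta> (\<mu> x) - \<mu> (\<delta> x) = 0" for x using Suc.prems(1) R_endos_commute[of \<delta> \<mu>] \<mu> by simp
      then show ?thesis using diffop_le_zero[OF assms(1)] by simp
    next
      case (Suc i')
      then have *: "(\<lambda>x. \<delta> (\<mu> x) - \<mu> (\<delta> x)) \<in> diffop_le scale i'"
        using Suc.prems(1) \<mu> by simp
      have n: "n = i' + j" using Suc.hyps(2) Suc by simp
      show ?thesis unfolding n by (rule Suc.hyps(1)[OF n * Suc.prems(2)])
    qed
    ultimately have 2: "(\<lambda>x. \<delta> (\<eta> (\<mu> x) - \<mu> (\<eta> x)) + (\<delta> (\<mu> (\<eta> x)) - \<mu> (\<delta> (\<eta> x))))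
        \<in> diffop_le scale n"
      by (rule diffop_le_add[OF assms(1)])
    have 3: "(\<lambda>x. \<delta> (\<eta> (\<mu> x)) - \<mu> (\<delta> (\<eta> x)))
        = (\<lambda>x. \<delta> (\<eta> (\<mu> x) - \<mu> (\<eta> x)) + (\<delta> (\<mu> (\<eta> x)) - \<mu> (\<delta> (\<eta> x))))"
    proof
      fix x
      show "\<delta> (\<eta> (\<mu> x)) - \<mu> (\<delta> (\<eta> x))
        = \<delta> (\<eta> (\<mu> x) - \<mu> (\<eta> x)) + (\<delta> (\<mu> (\<eta> x)) - \<mu> (\<delta> (\<eta> x)))"
        using lin(1)[of "\<eta> (\<mu> x) - \<mu> (\<eta> x)" "\<mu> (\<eta> x)"] by simp
    qed
    show ?thesis unfolding 3 by (rule 2)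
  qed
  moreover have "\<delta> (\<eta> (x + y)) = \<delta> (\<eta> x) + \<delta> (\<eta> y)" for x y by (simp only: lin)
  moreover have "\<delta> (\<eta> (scale c x)) = scale c (\<delta> (\<eta> x))" for c x by (simp only: lin)
  ultimately show ?case
    unfolding Suc.hyps(2)[symmetric] diffop_le_Suc_iff[OF assms(1)] by (intro conjI allI ballI)
qed

lemma in_diffop_iff: "\<delta> \<in> carrier (diffop_ring scale) \<longleftrightarrow> (\<exists>i. \<delta> \<in> diffop_le scale i)"
  by (simp add: diffop_ring_def)

lemma mult_in_diffop: "(\<lambda>x. a * x) \<in> carrier (diffop_ring scale)"
  unfolding in_diffop_iff by (rule exI[of _ 0]) (simp add: mult_in_R_endos)

lemma diffop_add_closed:
  assumes "k_algebra scale" "\<delta> \<in> carrier (diffop_ring scale)" "\<eta> \<in> carrier (diffop_ring scale)"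
  shows "(\<lambda>x. \<delta> x + \<eta> x) \<in> carrier (diffop_ring scale)"
proof -
  obtain i j where "\<delta> \<in> diffop_le scale i" "\<eta> \<in> diffop_le scale j"
    using assms(2,3) by (auto simp: in_diffop_iff)
  then have "(\<lambda>x. \<delta> x + \<eta> x) \<in> diffop_le scale (max i j)"
    by (intro diffop_le_add[OF assms(1)]) (auto intro: diffop_le_mono[OF assms(1)])
  then show ?thesis by (auto simp: in_diffop_iff)
qed

lemma ring_diffop_ring:
  assumes "k_algebra scale"
  shows "ring (diffop_ring scale)"
proof -
  note sel = diffop_ring_def
  have add: "x \<oplus>\<^bsub>diffop_ring scale\<^esub> y = (\<lambda>z. x z + y z)" for x y by (simp add: sel)
  have mul: "x \<otimes>\<^bsub>diffop_ring scale\<^esub> y = (\<lambda>z. x (y z))" for x y by (auto simp: sel)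
  have zero: "\<zero>\<^bsub>diffop_ring scale\<^esub> = (\<lambda>_. 0)" by (simp add: sel)
  have one: "\<one>\<^bsub>diffop_ring scale\<^esub> = (\<lambda>z. z)" by (auto simp: sel)
  have lin: "\<delta> (x + y) = \<delta> x + \<delta> y" if "\<delta> \<in> carrier (diffop_ring scale)" for \<delta> x y
    using that diffop_le_linear[OF assms] by (auto simp: in_diffop_iff)
  show ?thesis
  proof (rule ringI)
    show "abelian_group (diffop_ring scale)"
    proof (rule abelian_groupI)
      show "\<exists>y\<in>carrier (diffop_ring scale). y \<oplus>\<^bsub>diffop_ring scale\<^esub> x = \<zero>\<^bsub>diffop_ring scale\<^esub>"
        if "x \<in> carrier (diffop_ring scale)" for x
        using that diffop_le_uminus[OF assms]
        by (intro bexI[of _ "\<lambda>z. - x z"]) (auto simp: add zero in_diffop_iff)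
      show "\<zero>\<^bsub>diffop_ring scale\<^esub> \<in> carrier (diffop_ring scale)"
        using diffop_le_zero[OF assms] by (auto simp: zero in_diffop_iff)
    qed (auto simp: add zero diffop_add_closed[OF assms] algebra_simps)
    show "Group.monoid (diffop_ring scale)"
    proof (rule monoidI)
      show "\<one>\<^bsub>diffop_ring scale\<^esub> \<in> carrier (diffop_ring scale)"
        using mult_in_diffop[of 1 scale] by (simp add: one)
      show "x \<otimes>\<^bsub>diffop_ring scale\<^esub> y \<in> carrier (diffop_ring scale)"
        if "x \<in> carrier (diffop_ring scale)" "y \<in> carrier (diffop_ring scale)" for x y
        using that diffop_le_comp[OF assms] unfolding mul in_diffop_iff by blast
    qed (auto simp: mul one)
  qed (auto simp: add mul lin)
qed

text \<open>\<open>UP\<close> is the library's ring of polynomials in a central indeterminate over a possibly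
  noncommutative ring; \<open>diffop_poly_at\<close> specializes the indeterminate to a natural number.\<close>

definition diffop_poly_at ::
  "('k::field \<Rightarrow> 'r::comm_ring_1 \<Rightarrow> 'r) \<Rightarrow> (nat \<Rightarrow> 'r \<Rightarrow> 'r) \<Rightarrow> nat \<Rightarrow> 'r \<Rightarrow> 'r" where
  "diffop_poly_at scale \<delta> n x =
     (\<Sum>j\<le>deg (diffop_ring scale) \<delta>.
        scale (of_nat n ^ j) (up_ring.coeff (UP (diffop_ring scale)) \<delta> j x))"

definition admits_bernstein_sato ::
  "('k::field \<Rightarrow> 'r::comm_ring_1 \<Rightarrow> 'r) \<Rightarrow> 'r \<Rightarrow> bool" where
  "admits_bernstein_sato scale h \<longleftrightarrow>
     (\<exists>\<delta> \<in> carrier (UP (diffop_ring scale)). \<exists>b :: 'k poly. b \<noteq> 0 \<and>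
        (\<forall>n::nat. diffop_poly_at scale \<delta> n (h ^ (n + 1)) = scale (poly b (of_nat n)) (h ^ n)))"

definition has_bernstein_sato :: "('k::field \<Rightarrow> 'r::comm_ring_1 \<Rightarrow> 'r) \<Rightarrow> bool" where
  "has_bernstein_sato scale \<longleftrightarrow> (\<forall>h. admits_bernstein_sato scale h)"


section \<open>Noncommutative rings and left modules\<close>

text \<open>The library's \<open>noetherian_ring\<close> and \<open>module\<close> are about two-sided ideals and
  commutative rings respectively, hence the following.\<close>

definition left_ideal :: "'a set \<Rightarrow> ('a, 'm) ring_scheme \<Rightarrow> bool" where
  "left_ideal I A \<longleftrightarrow>
     additive_subgroup I A \<and> (\<forall>a\<in>carrier A. \<forall>x\<in>I. a \<otimes>\<^bsub>A\<^esub> x \<in> I)"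

definition right_ideal :: "'a set \<Rightarrow> ('a, 'm) ring_scheme \<Rightarrow> bool" where
  "right_ideal I A \<longleftrightarrow>
     additive_subgroup I A \<and> (\<forall>a\<in>carrier A. \<forall>x\<in>I. x \<otimes>\<^bsub>A\<^esub> a \<in> I)"

definition left_right_noetherian :: "('a, 'm) ring_scheme \<Rightarrow> bool" where
  "left_right_noetherian A \<longleftrightarrow> ring A \<and>
     (\<forall>I. left_ideal I A \<longrightarrow>
        (\<exists>S. finite S \<and> S \<subseteq> I \<and> (\<forall>J. left_ideal J A \<longrightarrow> S \<subseteq> J \<longrightarrow> I \<subseteq> J))) \<and>
     (\<forall>I. right_ideal I A \<longrightarrow>
        (\<exists>S. finite S \<and> S \<subseteq> I \<and> (\<forall>J. right_ideal J A \<longrightarrow> S \<subseteq> J \<longrightarrow> I \<subseteq> J)))"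

text \<open>The Cech complex refers to a finite generating list of the ideal. One always exists when the
  ring of differential operators is right Noetherian.\<close>

lemma ideal_finitely_generated:
  fixes scale :: "'k::field \<Rightarrow> 'r::comm_ring_1 \<Rightarrow> 'r"
  assumes alg: "k_algebra scale" and noeth: "left_right_noetherian (diffop_ring scale)"
    and \<aa>: "ideal \<aa> (ring_of_type_algebra :: 'r ring)"
  shows "\<exists>fs. \<aa> = Idl\<^bsub>(ring_of_type_algebra :: 'r ring)\<^esub> (set fs)"
proof -
  let ?R = "ring_of_type_algebra :: 'r ring" and ?D = "diffop_ring scale"
  interpret R: cring ?R by (rule cring_from_type_algebra)
  interpret D: ring ?D by (rule ring_diffop_ring[OF alg])
  have R_simps: "carrier ?R = UNIV" "x \<oplus>\<^bsub>?R\<^esub> y = x + y" "x \<otimes>\<^bsub>?R\<^esub> y = x * y" "\<zero>\<^bsub>?R\<^esub> = 0" for x y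
    by (simp_all add: ring_of_type_algebra_def)
  have D_simps: "\<delta> \<oplus>\<^bsub>?D\<^esub> \<eta> = (\<lambda>x. \<delta> x + \<eta> x)" "\<delta> \<otimes>\<^bsub>?D\<^esub> \<eta> = (\<lambda>x. \<delta> (\<eta> x))" "\<zero>\<^bsub>?D\<^esub> = (\<lambda>_. 0)" for \<delta> \<eta>
    by (auto simp: diffop_ring_def)
  have neg: "\<ominus>\<^bsub>?D\<^esub> \<delta> = (\<lambda>x. - \<delta> x)" if "\<delta> \<in> carrier ?D" for \<delta>
  proof -
    have "(\<ominus>\<^bsub>?D\<^esub> \<delta>) \<oplus>\<^bsub>?D\<^esub> \<delta> = \<zero>\<^bsub>?D\<^esub>" by (rule D.l_neg[OF that])
    then have "(\<ominus>\<^bsub>?D\<^esub> \<delta>) x + \<delta> x = 0" for x unfolding D_simps by (rule fun_cong)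
    then show ?thesis by (auto simp: eq_neg_iff_add_eq_0)
  qed
  define E where "E I = {\<delta> \<in> carrier ?D. range \<delta> \<subseteq> I}" for I
  have idl: "ideal (Idl\<^bsub>?R\<^esub> F) ?R" for F
    by (rule R.genideal_ideal) (simp add: R_simps)
  have F_sub: "F \<subseteq> Idl\<^bsub>?R\<^esub> F" for F
    by (rule R.genideal_self) (simp add: R_simps)
  have ideal_closed: "0 \<in> I" "x \<in> I \<Longrightarrow> y \<in> I \<Longrightarrow> x + y \<in> I" "x \<in> I \<Longrightarrow> - x \<in> I" "x \<in> I \<Longrightarrow> x * r \<in> I"
    if "ideal I ?R" for I x y r
  proof -
    interpret ideal I ?R by (rule that)
    show "0 \<in> I" using zero_closed by (simp add: R_simps)
    show "x \<in> I \<Longrightarrow> y \<in> I \<Longrightarrow> x + y \<in> I" using a_closed[of x y] by (simp add: R_simps)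
    show mr: "x \<in> I \<Longrightarrow> x * r \<in> I" for r using I_r_closed[of x r] by (simp add: R_simps)
    show "x \<in> I \<Longrightarrow> - x \<in> I" using mr[of "-1"] by simp
  qed
  have add_sub: "additive_subgroup H ?D"
    if "H \<subseteq> carrier ?D" "(\<lambda>_. 0) \<in> H" "\<And>\<delta> \<eta>. \<delta> \<in> H \<Longrightarrow> \<eta> \<in> H \<Longrightarrow> (\<lambda>x. \<delta> x + \<eta> x) \<in> H"
      "\<And>\<delta>. \<delta> \<in> H \<Longrightarrow> (\<lambda>x. - \<delta> x) \<in> H" for H
  proof (intro additive_subgroup.intro subgroup.intro)
    show "inv\<^bsub>add_monoid ?D\<^esub> \<delta> \<in> H" if "\<delta> \<in> H" for \<delta>
      using \<open>\<And>\<delta>. \<delta> \<in> H \<Longrightarrow> (\<lambda>x. - \<delta> x) \<in> H\<close>[OF that] neg[of \<delta>] that \<open>H \<subseteq> carrier ?D\<close>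
      unfolding a_inv_def by auto
  qed (use that in \<open>auto simp: D_simps\<close>)
  have zD: "(\<lambda>_. 0) \<in> carrier ?D" using D.zero_closed by (simp only: D_simps)
  have E_zero: "(\<lambda>_. 0) \<in> E I" if I: "ideal I ?R" for I
    using zD ideal_closed(1)[OF I] by (auto simp: E_def)
  have E_add: "(\<lambda>x. \<delta> x + \<eta> x) \<in> E I" if I: "ideal I ?R" and "\<delta> \<in> E I" "\<eta> \<in> E I" for I \<delta> \<eta>
  proof -
    have "\<delta> \<in> carrier ?D" "\<eta> \<in> carrier ?D" "\<And>x. \<delta> x \<in> I" "\<And>x. \<eta> x \<in> I" using that by (auto simp: E_def)
    then show ?thesis
      using diffop_add_closed[OF alg, of \<delta> \<eta>] ideal_closed(2)[OF I] by (simp add: E_def image_subset_iff)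
  qed
  have E_neg: "(\<lambda>x. - \<delta> x) \<in> E I" if I: "ideal I ?R" and "\<delta> \<in> E I" for I \<delta>
  proof -
    have \<delta>: "\<delta> \<in> carrier ?D" "\<And>x. \<delta> x \<in> I" using that by (auto simp: E_def)
    then have "(\<lambda>x. - \<delta> x) \<in> carrier ?D" using D.a_inv_closed[OF \<delta>(1)] by (simp only: neg)
    with \<delta> show ?thesis using ideal_closed(3)[OF I] by (simp add: E_def image_subset_iff)
  qed
  have E_mult: "\<delta> \<otimes>\<^bsub>?D\<^esub> \<eta> \<in> E I" if "\<delta> \<in> E I" "\<eta> \<in> carrier ?D" for I \<delta> \<eta>
  proof -
    have \<delta>: "\<delta> \<in> carrier ?D" "\<And>x. \<delta> x \<in> I" using that by (auto simp: E_def)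
    from D.m_closed[OF \<delta>(1) that(2)] show ?thesis using \<delta>(2) by (auto simp: E_def D_simps)
  qed
  have E_right: "right_ideal (E I) ?D" if I: "ideal I ?R" for I
    unfolding right_ideal_def
  proof (intro conjI ballI)
    show "additive_subgroup (E I) ?D"
      by (rule add_sub[OF _ E_zero[OF I] E_add[OF I] E_neg[OF I]]) (auto simp: E_def)
    show "x \<otimes>\<^bsub>?D\<^esub> a \<in> E I" if "a \<in> carrier ?D" "x \<in> E I" for a x
      using that by (rule E_mult[rotated])
  qed
  define U where "U = (\<Union>F\<in>{F. finite F \<and> F \<subseteq> \<aa>}. E (Idl\<^bsub>?R\<^esub> F))"
  have mono: "E (Idl\<^bsub>?R\<^esub> F) \<subseteq> E (Idl\<^bsub>?R\<^esub> G)" if "F \<subseteq> G" for F G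
    using R.genideal_minimal[OF idl[of G], of F] F_sub[of G] that unfolding E_def by blast
  have U_right: "right_ideal U ?D"
    unfolding right_ideal_def
  proof (intro conjI ballI)
    show "additive_subgroup U ?D"
    proof (rule add_sub)
      show "U \<subseteq> carrier ?D" by (auto simp: U_def E_def)
      show "(\<lambda>_. 0) \<in> U"
        unfolding U_def using E_zero[OF idl[of "{}"]] by blast
      show "(\<lambda>x. \<delta> x + \<eta> x) \<in> U" if \<delta>: "\<delta> \<in> U" and \<eta>: "\<eta> \<in> U" for \<delta> \<eta>
      proof -
        obtain F G where FG: "finite F" "F \<subseteq> \<aa>" "\<delta> \<in> E (Idl\<^bsub>?R\<^esub> F)" "finite G" "G \<subseteq> \<aa>" "\<eta> \<in> E (Idl\<^bsub>?R\<^esub> G)"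
          using \<delta> \<eta> by (auto simp: U_def)
        then have "\<delta> \<in> E (Idl\<^bsub>?R\<^esub> (F \<union> G))" "\<eta> \<in> E (Idl\<^bsub>?R\<^esub> (F \<union> G))"
          using mono[of F "F \<union> G"] mono[of G "F \<union> G"] by auto
        then have "(\<lambda>x. \<delta> x + \<eta> x) \<in> E (Idl\<^bsub>?R\<^esub> (F \<union> G))"
          by (rule E_add[OF idl])
        moreover have "finite (F \<union> G)" "F \<union> G \<subseteq> \<aa>" using FG by auto
        ultimately show ?thesis unfolding U_def by blast
      qed
      show "(\<lambda>x. - \<delta> x) \<in> U" if "\<delta> \<in> U" for \<delta>
        using that E_neg[OF idl, of \<delta>] unfolding U_def by blast
    qed
    show "x \<otimes>\<^bsub>?D\<^esub> a \<in> U" if "a \<in> carrier ?D" "x \<in> U" for a x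
      using that E_mult[of x _ a] unfolding U_def by blast
  qed
  then obtain S where S: "finite S" "S \<subseteq> U" "\<And>J. right_ideal J ?D \<Longrightarrow> S \<subseteq> J \<Longrightarrow> U \<subseteq> J"
    using noeth unfolding left_right_noetherian_def by meson
  have "\<forall>s\<in>S. \<exists>F. finite F \<and> F \<subseteq> \<aa> \<and> s \<in> E (Idl\<^bsub>?R\<^esub> F)" using S(2) by (auto simp: U_def)
  then obtain F where F: "\<And>s. s \<in> S \<Longrightarrow> finite (F s) \<and> F s \<subseteq> \<aa> \<and> s \<in> E (Idl\<^bsub>?R\<^esub> (F s))" by metis
  define G where "G = (\<Union>s\<in>S. F s)"
  have G: "finite G" "G \<subseteq> \<aa>" using F S(1) by (auto simp: G_def)
  have "S \<subseteq> E (Idl\<^bsub>?R\<^esub> G)" using F mono[of "F _" G] by (fastforce simp: G_def)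
  then have UG: "U \<subseteq> E (Idl\<^bsub>?R\<^esub> G)" by (rule S(3)[OF E_right[OF idl]])
  have "\<aa> \<subseteq> Idl\<^bsub>?R\<^esub> G"
  proof
    fix a assume a: "a \<in> \<aa>"
    have "a * x \<in> Idl\<^bsub>?R\<^esub> {a}" for x by (rule ideal_closed(4)[OF idl]) (use F_sub[of "{a}"] in blast)
    then have "(\<lambda>x. a * x) \<in> E (Idl\<^bsub>?R\<^esub> {a})" by (auto simp: E_def mult_in_diffop)
    then have "(\<lambda>x. a * x) \<in> U" using a by (auto simp: U_def intro!: exI[of _ "{a}"])
    then have "a * 1 \<in> Idl\<^bsub>?R\<^esub> G" using UG unfolding E_def by blast
    then show "a \<in> Idl\<^bsub>?R\<^esub> G" by simp
  qed
  moreover have "Idl\<^bsub>?R\<^esub> G \<subseteq> \<aa>" by (rule R.genideal_minimal[OF \<aa> G(2)])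
  moreover obtain fs where "set fs = G" using finite_list[OF G(1)] by blast
  ultimately show ?thesis by blast
qed

locale left_module = A?: ring A + M?: abelian_group M
  for A :: "('a, 'm) ring_scheme" (structure) and M :: "('a, 'b, 'n) module_scheme" (structure) +
  assumes smult_closed: "\<lbrakk>a \<in> carrier A; x \<in> carrier M\<rbrakk> \<Longrightarrow> a \<odot>\<^bsub>M\<^esub> x \<in> carrier M"
    and smult_l_distr: "\<lbrakk>a \<in> carrier A; b \<in> carrier A; x \<in> carrier M\<rbrakk> \<Longrightarrow>
      (a \<oplus>\<^bsub>A\<^esub> b) \<odot>\<^bsub>M\<^esub> x = (a \<odot>\<^bsub>M\<^esub> x) \<oplus>\<^bsub>M\<^esub> (b \<odot>\<^bsub>M\<^esub> x)"
    and smult_r_distr: "\<lbrakk>a \<in> carrier A; x \<in> carrier M; y \<in> carrier M\<rbrakk> \<Longrightarrow>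
      a \<odot>\<^bsub>M\<^esub> (x \<oplus>\<^bsub>M\<^esub> y) = (a \<odot>\<^bsub>M\<^esub> x) \<oplus>\<^bsub>M\<^esub> (a \<odot>\<^bsub>M\<^esub> y)"
    and smult_assoc: "\<lbrakk>a \<in> carrier A; b \<in> carrier A; x \<in> carrier M\<rbrakk> \<Longrightarrow>
      (a \<otimes>\<^bsub>A\<^esub> b) \<odot>\<^bsub>M\<^esub> x = a \<odot>\<^bsub>M\<^esub> (b \<odot>\<^bsub>M\<^esub> x)"
    and smult_one: "x \<in> carrier M \<Longrightarrow> \<one>\<^bsub>A\<^esub> \<odot>\<^bsub>M\<^esub> x = x"

text \<open>The library predicate \<open>submodule\<close> itself makes no commutativity assumption.\<close>

definition fin_gen_left_module ::
  "('a, 'm) ring_scheme \<Rightarrow> ('a, 'b, 'n) module_scheme \<Rightarrow> bool" where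
  "fin_gen_left_module A M \<longleftrightarrow> left_module A M \<and>
     (\<exists>S. finite S \<and> S \<subseteq> carrier M \<and>
        (\<forall>N. submodule N A M \<longrightarrow> S \<subseteq> N \<longrightarrow> N = carrier M))"

text \<open>Associated primes over \<open>R\<close> of a module over the ring of differential operators; \<open>R\<close> acts
  through its multiplication operators.\<close>

definition ass_primes :: "('r::comm_ring_1 \<Rightarrow> 'r, 'b, 'n) module_scheme \<Rightarrow> 'r set set" where
  "ass_primes M = {P. primeideal P (ring_of_type_algebra :: 'r ring) \<and>
     (\<exists>m\<in>carrier M. P = {r. (\<lambda>x. r * x) \<odot>\<^bsub>M\<^esub> m = \<zero>\<^bsub>M\<^esub>})}"

text \<open>The quotient \<open>Z / B\<close> for subgroups \<open>B \<subseteq> Z\<close> of \<open>M\<close>, with elements the cosets of \<open>B\<close>. The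
  ring multiplication and unit that a \<open>module\<close> record carries are irrelevant and left
  undefined, here and below. The union in \<open>smult\<close> is over equal cosets when \<open>B\<close> is a
  submodule.\<close>

definition subquotient ::
  "('a, 'b, 'n) module_scheme \<Rightarrow> 'b set \<Rightarrow> 'b set \<Rightarrow> ('a, 'b set) module" where
  "subquotient M Z B =
     \<lparr>carrier = (\<lambda>z. B +>\<^bsub>M\<^esub> z) ` Z, monoid.mult = undefined, one = undefined,
      ring.zero = B, add = set_add M,
      module.smult = (\<lambda>a u. \<Union>z\<in>u. B +>\<^bsub>M\<^esub> (a \<odot>\<^bsub>M\<^esub> z))\<rparr>"


section \<open>Localization\<close>

text \<open>Fractions are equivalence classes of pairs (numerator, denominator). Operations on
  classes are unions, over all representatives, of the resulting classes, which coincide.\<close>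

definition loc_rel :: "'r::comm_ring_1 set \<Rightarrow> (('r \<times> 'r) \<times> ('r \<times> 'r)) set" where
  "loc_rel W = {((r, w), (r', w')). w \<in> W \<and> w' \<in> W \<and> (\<exists>t\<in>W. t * (r * w' - r' * w) = 0)}"

definition loc_frac :: "'r::comm_ring_1 set \<Rightarrow> 'r \<Rightarrow> 'r \<Rightarrow> ('r \<times> 'r) set" where
  "loc_frac W r w = loc_rel W `` {(r, w)}"

definition loc_ring :: "'r::comm_ring_1 set \<Rightarrow> ('r \<times> 'r) set ring" where
  "loc_ring W =
     \<lparr>carrier = (UNIV \<times> W) // loc_rel W,
      monoid.mult = (\<lambda>u v. \<Union>(r, w)\<in>u. \<Union>(r', w')\<in>v. loc_frac W (r * r') (w * w')),
      one = loc_frac W 1 1,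
      ring.zero = loc_frac W 0 1,
      add = (\<lambda>u v. \<Union>(r, w)\<in>u. \<Union>(r', w')\<in>v. loc_frac W (r * w' + r' * w) (w * w'))\<rparr>"

primrec iter_comm :: "('r::comm_ring_1 \<Rightarrow> 'r) \<Rightarrow> 'r \<Rightarrow> nat \<Rightarrow> 'r \<Rightarrow> 'r" where
  "iter_comm \<delta> g 0 = \<delta>"
| "iter_comm \<delta> g (Suc j) = (\<lambda>x. iter_comm \<delta> g j (g * x) - g * iter_comm \<delta> g j x)"

text \<open>The order \<open>t\<close> is taken to be the least possible; \<open>iter_comm \<delta> g j\<close> vanishes for \<open>j > t\<close>, so
  any larger choice gives the same sum.\<close>

definition diffop_order ::
  "('k::field \<Rightarrow> 'r::comm_ring_1 \<Rightarrow> 'r) \<Rightarrow> ('r \<Rightarrow> 'r) \<Rightarrow> nat" where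
  "diffop_order scale \<delta> = (LEAST t. \<delta> \<in> diffop_le scale t)"

definition loc_module ::
  "('k::field \<Rightarrow> 'r::comm_ring_1 \<Rightarrow> 'r) \<Rightarrow> 'r set \<Rightarrow> ('r \<Rightarrow> 'r, ('r \<times> 'r) set) module" where
  "loc_module scale W =
     \<lparr>carrier = carrier (loc_ring W), monoid.mult = monoid.mult (loc_ring W),
      one = one (loc_ring W), ring.zero = ring.zero (loc_ring W), add = add (loc_ring W),
      module.smult = (\<lambda>\<delta> u. \<Union>(r, g)\<in>u.
        \<Oplus>\<^bsub>loc_ring W\<^esub>j\<in>{..diffop_order scale \<delta>}.
          loc_frac W ((- 1) ^ j * iter_comm \<delta> g j r) (g ^ (j + 1)))\<rparr>"


section \<open>The Cech complex and local cohomology\<close>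

text \<open>For \<open>fs = [f\<^sub>0, \<dots>, f\<^sub>l\<^sub>-\<^sub>1]\<close>, cochains of degree \<open>i\<close> are families indexed by the \<open>i\<close>-element
  sets \<open>J\<close> of positions, the component at \<open>J\<close> lying in the localization of \<open>R\<close> at the powers of
  \<open>\<Prod>j\<in>J. f\<^sub>j\<close>. In degree 0 this is the localization at the powers of 1, that is, \<open>R\<close>.\<close>

definition cech_index :: "'r list \<Rightarrow> nat \<Rightarrow> nat set set" where
  "cech_index fs i = {J. J \<subseteq> {..<length fs} \<and> card J = i}"

definition cech_prod :: "'r::comm_ring_1 list \<Rightarrow> nat set \<Rightarrow> 'r" where
  "cech_prod fs J = (\<Prod>j\<in>J. fs ! j)"

definition powers_of :: "'r::comm_ring_1 \<Rightarrow> 'r set" where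
  "powers_of g = range (\<lambda>n::nat. g ^ n)"

abbreviation cech_loc ::
  "('k::field \<Rightarrow> 'r::comm_ring_1 \<Rightarrow> 'r) \<Rightarrow> 'r list \<Rightarrow> nat set \<Rightarrow>
     ('r \<Rightarrow> 'r, ('r \<times> 'r) set) module" where
  "cech_loc scale fs J \<equiv> loc_module scale (powers_of (cech_prod fs J))"

definition cech_module ::
  "('k::field \<Rightarrow> 'r::comm_ring_1 \<Rightarrow> 'r) \<Rightarrow> 'r list \<Rightarrow> nat \<Rightarrow>
     ('r \<Rightarrow> 'r, nat set \<Rightarrow> ('r \<times> 'r) set) module" where
  "cech_module scale fs i =
     \<lparr>carrier = (\<Pi>\<^sub>E J\<in>cech_index fs i. carrier (cech_loc scale fs J)),
      monoid.mult = undefined, one = undefined,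
      ring.zero = (\<lambda>J\<in>cech_index fs i. \<zero>\<^bsub>cech_loc scale fs J\<^esub>),
      add = (\<lambda>c c'. \<lambda>J\<in>cech_index fs i. c J \<oplus>\<^bsub>cech_loc scale fs J\<^esub> c' J),
      module.smult = (\<lambda>\<delta> c. \<lambda>J\<in>cech_index fs i. \<delta> \<odot>\<^bsub>cech_loc scale fs J\<^esub> c J)\<rparr>"

text \<open>The canonical map from the localization at \<open>g\<close> to the localization at \<open>g h\<close>, sending
  \<open>r / g\<^sup>n\<close> to \<open>r h\<^sup>n / (g h)\<^sup>n\<close>.\<close>

definition loc_map :: "'r::comm_ring_1 \<Rightarrow> 'r \<Rightarrow> ('r \<times> 'r) set \<Rightarrow> ('r \<times> 'r) set" where
  "loc_map g h u =
     \<Union>{loc_frac (powers_of (g * h)) (r * h ^ n) ((g * h) ^ n) | r n. (r, g ^ n) \<in> u}"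

definition cech_diff ::
  "('k::field \<Rightarrow> 'r::comm_ring_1 \<Rightarrow> 'r) \<Rightarrow> 'r list \<Rightarrow> nat \<Rightarrow>
     (nat set \<Rightarrow> ('r \<times> 'r) set) \<Rightarrow> nat set \<Rightarrow> ('r \<times> 'r) set" where
  "cech_diff scale fs i c =
     (\<lambda>J\<in>cech_index fs (Suc i). \<Oplus>\<^bsub>cech_loc scale fs J\<^esub>k\<in>J.
        (let y = loc_map (cech_prod fs (J - {k})) (fs ! k) (c (J - {k}))
         in if even (card {j\<in>J. j < k}) then y else \<ominus>\<^bsub>cech_loc scale fs J\<^esub> y))"

definition cech_cocycles ::
  "('k::field \<Rightarrow> 'r::comm_ring_1 \<Rightarrow> 'r) \<Rightarrow> 'r list \<Rightarrow> nat \<Rightarrow>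
     (nat set \<Rightarrow> ('r \<times> 'r) set) set" where
  "cech_cocycles scale fs i =
     a_kernel (cech_module scale fs i) (cech_module scale fs (Suc i)) (cech_diff scale fs i)"

primrec cech_coboundaries ::
  "('k::field \<Rightarrow> 'r::comm_ring_1 \<Rightarrow> 'r) \<Rightarrow> 'r list \<Rightarrow> nat \<Rightarrow>
     (nat set \<Rightarrow> ('r \<times> 'r) set) set" where
  "cech_coboundaries scale fs 0 = {\<zero>\<^bsub>cech_module scale fs 0\<^esub>}"
| "cech_coboundaries scale fs (Suc i) =
     cech_diff scale fs i ` carrier (cech_module scale fs i)"

text \<open>\<open>local_cohomology scale fs i\<close> is the \<open>i\<close>-th local cohomology module of \<open>R\<close> with support in the
  ideal generated by \<open>fs\<close>.\<close>

definition local_cohomology ::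
  "('k::field \<Rightarrow> 'r::comm_ring_1 \<Rightarrow> 'r) \<Rightarrow> 'r list \<Rightarrow> nat \<Rightarrow>
     ('r \<Rightarrow> 'r, (nat set \<Rightarrow> ('r \<times> 'r) set) set) module" where
  "local_cohomology scale fs i =
     subquotient (cech_module scale fs i) (cech_cocycles scale fs i)
       (cech_coboundaries scale fs i)"

end

theory Submission
  imports Defs
begin

text \<open>Write \<open>D\<close> for the ring of differential operators of \<open>R\<close> over \<open>K\<close>. The modules of the Cech
  complex are finite products of localizations \<open>R\<^sub>h\<close>, and its differentials are \<open>D\<close>-linear. Hence
  finite generation of all local cohomology follows from the left Noetherian property of \<open>D\<close> as soon
  as each \<open>R\<^sub>h\<close> is finitely generated, and in fact \<open>R\<^sub>h\<close> is generated by a single power of \<open>1/h\<close>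
  (\<open>localization_cyclic\<close>). The reason is the Bernstein-Sato equation \<open>\<delta>(s) h\<^sup>s\<^sup>+\<^sup>1 = b(s) h\<^sup>s\<close>. It is
  given for natural \<open>s\<close>, but up to powers of \<open>h\<close> both sides are polynomials in \<open>s\<close>, so in
  characteristic zero it persists at negative integers. Since \<open>b\<close> has finitely many roots,
  \<open>1/h\<^sup>n\<^sup>+\<^sup>1\<close> is then a \<open>D\<close>-multiple of \<open>1/h\<^sup>n\<close> for all large \<open>n\<close>.

  One family of operators carries all computations with denominators: \<open>conj_op g t \<delta> x\<close> is
  \<open>g\<^sup>t\<close> times the formal conjugate \<open>g\<^sup>-\<^sup>x \<delta> g\<^sup>x\<close>, where \<open>t\<close> bounds the order of \<open>\<delta>\<close>. It depends
  polynomially on \<open>x\<close>, and at \<open>x = -n\<close> it yields an Ore condition: for all \<open>\<delta>\<close> and \<open>g\<close> some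
  \<open>\<epsilon>\<close> in \<open>D\<close> satisfies \<open>\<epsilon> g\<^sup>n = g\<^sup>n\<^sup>+\<^sup>t \<delta>\<close>. Every such relation \<open>\<epsilon> g = w \<delta>\<close> computes the action
  on a localization by \<open>\<delta> (r/g) = \<epsilon>(r)/w\<close> (\<open>smult_frac\<close>), from which the module axioms and the
  linearity of the localization maps are immediate.

  For the associated primes let \<open>M\<close> be a Noetherian \<open>D\<close>-module. If some quotient of \<open>M\<close> had infinitely
  many, take a largest submodule \<open>N\<close> for which \<open>M/N\<close> has, and let \<open>P\<close> be maximal among the
  associated primes of \<open>M/N\<close>. By the Ore condition the elements of \<open>M/N\<close> that are torsion with respect to
  every element of \<open>P\<close> form a \<open>D\<close>-submodule \<open>T/N\<close>, which is nonzero. Passing from \<open>M/N\<close> to \<open>M/T\<close>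
  loses no associated prime except \<open>P\<close>, contradicting the choice of \<open>N\<close>
  (\<open>finite_ass_primes_mod\<close>).\<close>

locale algebra_char_0 =
  fixes scale :: "'k::field_char_0 \<Rightarrow> 'r::comm_ring_1 \<Rightarrow> 'r"
  assumes alg: "k_algebra scale"
begin

sublocale V: vector_space scale
  using alg by (simp add: k_algebra_def)

abbreviation D :: "('r \<Rightarrow> 'r) ring" where
  "D \<equiv> diffop_ring scale"

lemma scale_mult_left: "scale c x * y = scale c (x * y)"
  using alg by (simp add: k_algebra_def)

lemma scale_mult_right: "x * scale c y = scale c (x * y)"
  using scale_mult_left[of c y x] by (simp add: mult.commute)

section \<open>Commuting a differential operator past powers of an element\<close>

lemma diffop_add: "\<delta> \<in> carrier D \<Longrightarrow> \<delta> (x + y) = \<delta> x + \<delta> y"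
  using diffop_le_linear(1)[OF alg] by (auto simp: in_diffop_iff)

lemma diffop_comp_closed:
  "\<delta> \<in> carrier D \<Longrightarrow> \<eta> \<in> carrier D \<Longrightarrow> (\<lambda>x. \<delta> (\<eta> x)) \<in> carrier D"
  using diffop_le_comp[OF alg] unfolding in_diffop_iff by blast

lemma diffop_mult_closed: "\<delta> \<in> carrier D \<Longrightarrow> (\<lambda>x. a * \<delta> x) \<in> carrier D"
  by (rule diffop_comp_closed[OF mult_in_diffop])

lemma diffop_scale_closed:
  assumes "\<delta> \<in> carrier D" shows "(\<lambda>x. scale c (\<delta> x)) \<in> carrier D"
  using diffop_mult_closed[OF assms, of "scale c 1"] by (simp add: scale_mult_left)

lemma diffop_sum_closed:
  assumes "finite A" "\<And>a. a \<in> A \<Longrightarrow> \<delta> a \<in> carrier D"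
  shows "(\<lambda>x. \<Sum>a\<in>A. \<delta> a x) \<in> carrier D"
  using assms
proof (induction A rule: finite_induct)
  case empty
  show ?case using mult_in_diffop[of 0 scale] by simp
next
  case (insert a A)
  then show ?case using diffop_add_closed[OF alg, of "\<delta> a" "\<lambda>x. \<Sum>a\<in>A. \<delta> a x"] by simp
qed

lemma iter_comm_order:
  assumes "\<delta> \<in> diffop_le scale t" "j \<le> t"
  shows "iter_comm \<delta> g j \<in> diffop_le scale (t - j)"
  using assms(2)
proof (induction j)
  case (Suc j)
  then have "iter_comm \<delta> g j \<in> diffop_le scale (Suc (t - Suc j))"
    by (simp add: Suc_diff_Suc)
  then show ?case
    using mult_in_R_endos[of g] unfolding diffop_le_Suc_iff[OF alg] by simp
qed (use assms in simp)

lemma iter_comm_diffop: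
  assumes "\<delta> \<in> carrier D" shows "iter_comm \<delta> g j \<in> carrier D"
proof (induction j)
  case (Suc j)
  have "(\<lambda>x. iter_comm \<delta> g j (g * x)) \<in> carrier D"
    by (rule diffop_comp_closed[OF Suc mult_in_diffop])
  moreover have "(\<lambda>x. (- g) * iter_comm \<delta> g j x) \<in> carrier D"
    by (rule diffop_mult_closed[OF Suc])
  ultimately have "(\<lambda>x. iter_comm \<delta> g j (g * x) + (- g) * iter_comm \<delta> g j x) \<in> carrier D"
    by (rule diffop_add_closed[OF alg])
  then show ?case by simp
qed (use assms in simp)

lemma iter_comm_vanishes:
  assumes \<delta>: "\<delta> \<in> diffop_le scale t" and "t < j"
  shows "iter_comm \<delta> g j = (\<lambda>_. 0)"
proof -
  have "iter_comm \<delta> g (Suc t + i) = (\<lambda>_. 0)" for i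
  proof (induction i)
    case 0
    have "iter_comm \<delta> g t \<in> R_endos"
      using iter_comm_order[OF \<delta>, of t g] by simp
    then show ?case by (simp add: R_endos_iff)
  qed simp
  from this[of "j - Suc t"] show ?thesis using assms(2) by simp
qed

text \<open>Since the commutation rule is \<open>\<delta> g\<^sup>n = \<Sum>\<^sub>j (n choose j) g\<^sup>n\<^sup>-\<^sup>j \<delta>\<^sup>(\<^sup>j\<^sup>)\<close> with
  \<open>\<delta>\<^sup>(\<^sup>j\<^sup>) = iter_comm \<delta> g j\<close>, the sum below is \<open>g\<^sup>t g\<^sup>-\<^sup>x \<delta> g\<^sup>x\<close> for \<open>\<delta>\<close> of order at most \<open>t\<close>. The
  factor \<open>g\<^sup>t\<close> clears the denominators, so that it is a differential operator on \<open>R\<close> for every scalar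
  \<open>x\<close>.\<close>

definition conj_op :: "'r \<Rightarrow> nat \<Rightarrow> ('r \<Rightarrow> 'r) \<Rightarrow> 'k \<Rightarrow> 'r \<Rightarrow> 'r" where
  "conj_op g t \<delta> x r = (\<Sum>j\<le>t. scale (x gchoose j) (g ^ (t - j) * iter_comm \<delta> g j r))"

lemma conj_op_diffop:
  assumes "\<delta> \<in> carrier D" shows "conj_op g t \<delta> x \<in> carrier D"
  unfolding conj_op_def[abs_def]
  by (intro diffop_sum_closed diffop_scale_closed diffop_mult_closed iter_comm_diffop assms) simp

lemma conj_op_0: "conj_op g t \<delta> 0 r = g ^ t * \<delta> r"
proof -
  have "conj_op g t \<delta> 0 r = (\<Sum>j\<in>{0}. scale (0 gchoose j) (g ^ (t - j) * iter_comm \<delta> g j r))"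
    unfolding conj_op_def by (rule sum.mono_neutral_right) (auto simp: gbinomial_0_left)
  then show ?thesis by simp
qed

text \<open>For the formal conjugate this says \<open>(g\<^sup>-\<^sup>x \<delta> g\<^sup>x) g = g (g\<^sup>-\<^sup>x\<^sup>-\<^sup>1 \<delta> g\<^sup>x\<^sup>+\<^sup>1)\<close>. With the commutator rule
  for \<open>\<delta>\<^sup>(\<^sup>j\<^sup>) g\<close> it becomes Pascal's rule for the coefficients; the sum over \<open>j\<close> stops at \<open>t\<close>
  because \<open>\<delta>\<^sup>(\<^sup>t\<^sup>+\<^sup>1\<^sup>) = 0\<close>.\<close>

lemma conj_op_mult:
  assumes "\<delta> \<in> diffop_le scale t"
  shows "conj_op g t \<delta> x (g * r) = g * conj_op g t \<delta> (x + 1) r"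
proof -
  let ?d = "\<lambda>j. iter_comm \<delta> g j r" and ?C = "\<lambda>j. x gchoose j"
  have shift: "iter_comm \<delta> g j (g * r) = g * ?d j + ?d (Suc j)" for j
    by simp
  have last: "?d (Suc t) = 0"
    using iter_comm_vanishes[OF assms, of "Suc t" g] by (simp add: fun_eq_iff del: iter_comm.simps)
  have "conj_op g t \<delta> x (g * r)
      = (\<Sum>j\<le>t. scale (?C j) (g * g ^ (t - j) * ?d j)) + (\<Sum>j\<le>t. scale (?C j) (g ^ (t - j) * ?d (Suc j)))"
    unfolding conj_op_def shift
    by (simp add: algebra_simps V.scale_right_distrib sum.distrib del: iter_comm.simps)
  also have "(\<Sum>j\<le>t. scale (?C j) (g ^ (t - j) * ?d (Suc j)))
      = (\<Sum>j<t. scale (?C j) (g ^ (t - j) * ?d (Suc j)))"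
    using last by (simp add: lessThan_Suc_atMost[symmetric] del: iter_comm.simps)
  also have "\<dots> = (\<Sum>j<t. scale (?C j) (g * g ^ (t - Suc j) * ?d (Suc j)))"
    by (rule sum.cong) (simp_all add: power_Suc[symmetric] Suc_diff_Suc del: iter_comm.simps power_Suc)
  also have "(\<Sum>j\<le>t. scale (?C j) (g * g ^ (t - j) * ?d j))
      = g * g ^ t * ?d 0 + (\<Sum>j<t. scale (?C (Suc j)) (g * g ^ (t - Suc j) * ?d (Suc j)))"
    by (simp add: sum.atMost_shift del: iter_comm.simps power_Suc)
  also have "g * g ^ t * ?d 0 + (\<Sum>j<t. scale (?C (Suc j)) (g * g ^ (t - Suc j) * ?d (Suc j)))
        + (\<Sum>j<t. scale (?C j) (g * g ^ (t - Suc j) * ?d (Suc j)))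
      = g * g ^ t * ?d 0 + (\<Sum>j<t. scale ((x + 1) gchoose Suc j) (g * g ^ (t - Suc j) * ?d (Suc j)))"
    unfolding gbinomial_Suc_Suc V.scale_left_distrib sum.distrib by (simp only: ac_simps)
  also have "\<dots> = (\<Sum>j\<le>t. scale ((x + 1) gchoose j) (g * g ^ (t - j) * ?d j))"
    by (simp add: sum.atMost_shift del: iter_comm.simps power_Suc)
  also have "\<dots> = g * conj_op g t \<delta> (x + 1) r"
    by (simp add: conj_op_def sum_distrib_left scale_mult_right mult.assoc)
  finally show ?thesis .
qed

lemma conj_op_power_mult:
  assumes "\<delta> \<in> diffop_le scale t"
  shows "conj_op g t \<delta> x (g ^ n * r) = g ^ n * conj_op g t \<delta> (x + of_nat n) r"
proof (induction n arbitrary: x)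
  case (Suc n)
  have "conj_op g t \<delta> x (g ^ Suc n * r) = g * conj_op g t \<delta> (x + 1) (g ^ n * r)"
    using conj_op_mult[OF assms, of g x "g ^ n * r"] by (simp add: mult.assoc)
  also have "\<dots> = g ^ Suc n * conj_op g t \<delta> (x + of_nat (Suc n)) r"
    unfolding Suc.IH by (simp add: algebra_simps)
  finally show ?case .
qed simp

lemma conj_op_of_nat:
  assumes "\<delta> \<in> diffop_le scale t"
  shows "g ^ n * conj_op g t \<delta> (of_nat n) r = g ^ t * \<delta> (g ^ n * r)"
  using conj_op_power_mult[OF assms, of g 0 n r] by (simp add: conj_op_0)

lemma conj_op_of_neg_nat:
  assumes "\<delta> \<in> diffop_le scale t"
  shows "conj_op g t \<delta> (- of_nat n) (g ^ n * r) = g ^ (n + t) * \<delta> r"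
  using conj_op_power_mult[OF assms, of g "- of_nat n" n r]
  by (simp add: conj_op_0 power_add mult.assoc)

text \<open>The left Ore condition for the powers of \<open>g\<close>: a right denominator can be moved to the left.\<close>

lemma diffop_ore:
  assumes "\<delta> \<in> carrier D"
  obtains \<epsilon> n where "\<epsilon> \<in> carrier D" "\<And>r. \<epsilon> (g * r) = g ^ n * \<delta> r"
proof -
  obtain t where t: "\<delta> \<in> diffop_le scale t" using assms by (auto simp: in_diffop_iff)
  have "conj_op g t \<delta> (- 1) (g * r) = g ^ (1 + t) * \<delta> r" for r
    using conj_op_of_neg_nat[OF t, of g 1 r] by simp
  with conj_op_diffop[OF assms] show ?thesis by (rule that)
qed

text \<open>If \<open>\<theta> g = 0\<close>, then every commutator with \<open>g\<close> just multiplies by \<open>-g\<close> on the left, and iterated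
  commutators of a differential operator vanish.\<close>

lemma diffop_right_cancel:
  assumes "\<theta> \<in> carrier D" and zero: "\<And>r. \<theta> (g * r) = 0"
  obtains n where "\<And>r. g ^ n * \<theta> r = 0"
proof -
  obtain t where t: "\<theta> \<in> diffop_le scale t" using assms by (auto simp: in_diffop_iff)
  have pow: "iter_comm \<theta> g j r = (- g) ^ j * \<theta> r" for j r
    by (induction j arbitrary: r) (simp_all add: zero)
  have "(- g) ^ Suc t * \<theta> r = 0" for r
    using pow[of "Suc t" r] iter_comm_vanishes[OF t, of "Suc t" g] by (simp del: iter_comm.simps)
  then have "(- 1) ^ Suc t * ((- g) ^ Suc t * \<theta> r) = 0" for r by simp
  then have "g ^ Suc t * \<theta> r = 0" for r
    using power_minus[of "- g" "Suc t"] by (simp only: minus_minus mult.assoc)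
  then show ?thesis by (rule that)
qed

section \<open>The Bernstein-Sato equation at negative integers\<close>

text \<open>A polynomial of degree at most \<open>d\<close> with coefficients in \<open>R\<close>, tested on linear functionals.
  Stated this way, the vanishing principle below reduces to counting roots in \<open>K\<close>.\<close>

definition polynomial_map :: "nat \<Rightarrow> ('k \<Rightarrow> 'r) \<Rightarrow> bool" where
  "polynomial_map d F \<longleftrightarrow>
     (\<forall>\<phi>. Vector_Spaces.linear scale (*) \<phi> \<longrightarrow> (\<exists>q. degree q \<le> d \<and> (\<forall>x. \<phi> (F x) = poly q x)))"

lemma separating_functional:
  assumes "v \<noteq> 0"
  obtains \<phi> :: "'r \<Rightarrow> 'k" where "Vector_Spaces.linear scale (*) \<phi>" "\<phi> v \<noteq> 0"
proof -
  interpret VP: vector_space_pair scale "(*) :: 'k \<Rightarrow> 'k \<Rightarrow> 'k"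
    by unfold_locales (simp_all add: algebra_simps)
  have "\<not> V.dependent {v}" using assms by (simp add: V.dependent_single)
  then have "VP.construct {v} (\<lambda>_. 1) v = 1"
    using VP.construct_basis[of "{v}" v "\<lambda>_. 1"] by simp
  then show ?thesis
    using that[OF VP.linear_construct[OF \<open>\<not> V.dependent {v}\<close>]] by (metis one_neq_zero)
qed

lemma functional_linear:
  assumes "Vector_Spaces.linear scale (*) (\<phi> :: 'r \<Rightarrow> 'k)"
  shows "\<phi> (x + y) = \<phi> x + \<phi> y" "\<phi> (scale c x) = c * \<phi> x"
  using assms by (simp_all add: linear_iff_module_hom module_hom_def module_hom_axioms_def)

lemma polynomial_map_monomial: "polynomial_map (degree p) (\<lambda>x. scale (poly p x) c)"
  unfolding polynomial_map_def
proof (intro allI impI)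
  fix \<phi> :: "'r \<Rightarrow> 'k" assume "Vector_Spaces.linear scale (*) \<phi>"
  then show "\<exists>q. degree q \<le> degree p \<and> (\<forall>x. \<phi> (scale (poly p x) c) = poly q x)"
    by (intro exI[of _ "smult (\<phi> c) p"]) (simp add: functional_linear mult.commute)
qed

lemma polynomial_map_mono: "polynomial_map d F \<Longrightarrow> d \<le> e \<Longrightarrow> polynomial_map e F"
  unfolding polynomial_map_def by (meson le_trans)

lemma polynomial_map_add:
  assumes "polynomial_map d F" "polynomial_map d G"
  shows "polynomial_map d (\<lambda>x. F x + G x)"
  unfolding polynomial_map_def
proof (intro allI impI)
  fix \<phi> :: "'r \<Rightarrow> 'k" assume \<phi>: "Vector_Spaces.linear scale (*) \<phi>"
  obtain p q where "degree p \<le> d" "degree q \<le> d" "\<And>x. \<phi> (F x) = poly p x" "\<And>x. \<phi> (G x) = poly q x"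
    using assms \<phi> unfolding polynomial_map_def by meson
  then show "\<exists>q. degree q \<le> d \<and> (\<forall>x. \<phi> (F x + G x) = poly q x)"
    by (intro exI[of _ "p + q"]) (simp add: functional_linear[OF \<phi>] degree_add_le)
qed

lemma polynomial_map_sum:
  assumes "finite A" "\<And>a. a \<in> A \<Longrightarrow> \<exists>d. polynomial_map d (F a)"
  shows "\<exists>d. polynomial_map d (\<lambda>x. \<Sum>a\<in>A. F a x)"
  using assms
proof (induction A rule: finite_induct)
  case empty
  show ?case using polynomial_map_monomial[of 0 0] by auto
next
  case (insert a A)
  then obtain d e where "polynomial_map d (F a)" "polynomial_map e (\<lambda>x. \<Sum>a\<in>A. F a x)" by blast
  then have "polynomial_map (max d e) (\<lambda>x. F a x + (\<Sum>a\<in>A. F a x))"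
    by (intro polynomial_map_add) (auto intro: polynomial_map_mono)
  then show ?case using insert.hyps by auto
qed

lemma polynomial_map_mult:
  assumes "polynomial_map d F" shows "polynomial_map d (\<lambda>x. a * F x)"
  unfolding polynomial_map_def
proof (intro allI impI)
  fix \<phi> :: "'r \<Rightarrow> 'k" assume \<phi>: "Vector_Spaces.linear scale (*) \<phi>"
  have "Vector_Spaces.linear scale (*) (\<lambda>x. \<phi> (a * x))"
    using \<phi> by (simp add: linear_iff_module_hom module_hom_def module_hom_axioms_def
        distrib_left scale_mult_right)
  then show "\<exists>q. degree q \<le> d \<and> (\<forall>x. \<phi> (a * F x) = poly q x)"
    using assms unfolding polynomial_map_def by blast
qed

text \<open>A nonzero value of \<open>F\<close> would be seen by a linear functional, which turns \<open>F\<close> into a nonzero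
  polynomial over \<open>K\<close> of degree at most \<open>d\<close> with \<open>d + 1\<close> distinct roots, as \<open>K\<close> has characteristic
  zero.\<close>

lemma polynomial_map_eq_0:
  assumes F: "polynomial_map d F" and zero: "\<And>n. n \<le> d \<Longrightarrow> F (of_nat n) = 0"
  shows "F x = 0"
proof (rule ccontr)
  assume "F x \<noteq> 0"
  then obtain \<phi> :: "'r \<Rightarrow> 'k" where \<phi>: "Vector_Spaces.linear scale (*) \<phi>" "\<phi> (F x) \<noteq> 0"
    by (rule separating_functional)
  then obtain q where q: "degree q \<le> d" "\<And>x. \<phi> (F x) = poly q x"
    using F unfolding polynomial_map_def by blast
  have "\<phi> 0 = 0" using functional_linear(1)[OF \<phi>(1), of 0 0] by simp
  then have "poly q y = poly 0 y" if "y \<in> of_nat ` {..d}" for y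
    using that zero q(2)[symmetric] by auto
  then have "q = 0"
    using q(1) by (intro poly_eqI_degree[of "of_nat ` {..d}"])
      (auto simp: card_image inj_on_def)
  then show False using \<phi>(2) q(2) by simp
qed

lemma gbinomial_poly: "\<exists>p. \<forall>x::'k. x gchoose j = poly p x"
  by (rule exI[of _ "smult (1 / fact j) (\<Prod>i=0..<j. [:- of_nat i, 1:])"])
    (simp add: gbinomial_prod_rev poly_prod)

lemma polynomial_map_conj_op: "\<exists>d. polynomial_map d (\<lambda>x. scale (x ^ k) (conj_op g t \<delta> (x + 1) r))"
proof -
  have "\<exists>d. polynomial_map d (\<lambda>x. scale (x ^ k * ((x + 1) gchoose j)) c)" for j c
  proof -
    obtain p where p: "\<And>x::'k. x gchoose j = poly p x" using gbinomial_poly by blast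
    have "(\<lambda>x. scale (x ^ k * ((x + 1) gchoose j)) c)
        = (\<lambda>x. scale (poly (monom 1 k * pcompose p [:1, 1:]) x) c)"
      by (simp add: p poly_monom poly_pcompose add.commute)
    then show ?thesis
      using polynomial_map_monomial[of "monom 1 k * pcompose p [:1, 1:]" c] by (simp only:) blast
  qed
  then have "\<exists>d. polynomial_map d
      (\<lambda>x. \<Sum>j\<le>t. scale (x ^ k * ((x + 1) gchoose j)) (g ^ (t - j) * iter_comm \<delta> g j r))"
    by (intro polynomial_map_sum) auto
  then show ?thesis by (simp add: conj_op_def V.scale_sum_right)
qed

text \<open>The Bernstein-Sato equation at \<open>s = -(n+1)\<close>. Here \<open>P n\<close> is \<open>\<delta>(-(n+1))\<close> and \<open>\<epsilon> n\<close> is an Ore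
  partner of it, so that \<open>P n (1/h\<^sup>n)\<close> is \<open>\<epsilon> n 1 / h\<^sup>n\<^sup>+\<^sup>t\<close> in \<open>R\<^sub>h\<close>; the last conclusion is
  \<open>P n (1/h\<^sup>n) = b(-(n+1)) / h\<^sup>n\<^sup>+\<^sup>1\<close> with denominators cleared. It holds because the equation at natural \<open>s\<close>
  says that a polynomial \<open>F\<close> satisfies \<open>h\<^sup>n F(n) = 0\<close> for all \<open>n\<close>. If \<open>e\<close> bounds the degree of
  \<open>F\<close>, then \<open>h\<^sup>e F\<close> has the \<open>e + 1\<close> zeros \<open>0, \<dots>, e\<close> and vanishes identically.\<close>

lemma bernstein_sato_at_negative_integers:
  assumes "admits_bernstein_sato scale h"
  obtains b :: "'k poly" and P \<epsilon> :: "nat \<Rightarrow> 'r \<Rightarrow> 'r" and t e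
  where "b \<noteq> 0" "\<And>n. P n \<in> carrier D" "\<And>n. \<epsilon> n \<in> carrier D"
    "\<And>n r. \<epsilon> n (h ^ n * r) = h ^ (n + t) * P n r"
    "\<And>n. h ^ (e + 1) * \<epsilon> n 1 = scale (poly b (- of_nat (n + 1))) (h ^ (t + e))"
proof -
  obtain \<Delta> and b :: "'k poly" where \<Delta>: "\<Delta> \<in> carrier (UP D)" and b: "b \<noteq> 0"
    and eq: "\<And>n::nat. diffop_poly_at scale \<Delta> n (h ^ (n + 1)) = scale (poly b (of_nat n)) (h ^ n)"
    using assms unfolding admits_bernstein_sato_def by blast
  define m where "m = deg D \<Delta>"
  define \<delta> where "\<delta> = up_ring.coeff (UP D) \<Delta>"
  have \<delta>: "\<delta> k \<in> carrier D" for k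
    using \<Delta> by (auto simp: \<delta>_def UP_def up_def)
  then have "\<forall>k. \<exists>t. \<delta> k \<in> diffop_le scale t" by (simp add: in_diffop_iff)
  then obtain ord where ord: "\<And>k. \<delta> k \<in> diffop_le scale (ord k)" by metis
  define t where "t = Max (ord ` {..m})"
  have t: "\<delta> k \<in> diffop_le scale t" if "k \<le> m" for k
    by (rule diffop_le_mono[OF alg ord]) (use that in \<open>simp add: t_def\<close>)
  have eq': "(\<Sum>k\<le>m. scale (of_nat n ^ k) (\<delta> k (h ^ (n + 1)))) = scale (poly b (of_nat n)) (h ^ n)" for n
    using eq[of n] by (simp add: diffop_poly_at_def m_def \<delta>_def)
  \<comment> \<open>For natural \<open>n\<close>, \<open>h\<^sup>n F(n)\<close> is \<open>h\<^sup>t\<close> times the difference of the two sides of the given equation.\<close>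
  define F where "F x = (\<Sum>k\<le>m. h * scale (x ^ k) (conj_op h t (\<delta> k) (x + 1) 1))
      + scale (poly b x) (- (h ^ t))" for x
  have hF: "h ^ n * F (of_nat n) = 0" for n
  proof -
    have "h ^ n * (h * scale (of_nat n ^ k) (conj_op h t (\<delta> k) (of_nat n + 1) 1))
        = h ^ t * scale (of_nat n ^ k) (\<delta> k (h ^ (n + 1)))" if "k \<le> m" for k
    proof -
      have "h ^ (n + 1) * conj_op h t (\<delta> k) (of_nat n + 1) 1 = h ^ t * \<delta> k (h ^ (n + 1))"
        using conj_op_of_nat[OF t[OF that], of h "n + 1" 1] by (simp add: add.commute)
      then show ?thesis by (simp add: scale_mult_right mult.left_commute mult.assoc)
    qed
    then have "h ^ n * F (of_nat n) = h ^ t * (\<Sum>k\<le>m. scale (of_nat n ^ k) (\<delta> k (h ^ (n + 1))))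
        + h ^ n * scale (poly b (of_nat n)) (- (h ^ t))"
      unfolding F_def distrib_left sum_distrib_left by simp
    then show ?thesis
      unfolding eq' by (simp add: scale_mult_right mult.commute)
  qed
  have "\<exists>d. polynomial_map d F"
  proof -
    have "\<exists>d. polynomial_map d (\<lambda>x. h * scale (x ^ k) (conj_op h t (\<delta> k) (x + 1) 1))" for k
      using polynomial_map_conj_op polynomial_map_mult by blast
    then obtain d1 where d1: "polynomial_map d1 (\<lambda>x. \<Sum>k\<le>m. h * scale (x ^ k) (conj_op h t (\<delta> k) (x + 1) 1))"
      using polynomial_map_sum[of "{..m}" "\<lambda>k x. h * scale (x ^ k) (conj_op h t (\<delta> k) (x + 1) 1)"]
      by blast
    have "polynomial_map (max d1 (degree b)) F"
      unfolding F_def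
      by (rule polynomial_map_add[OF polynomial_map_mono[OF d1 max.cobounded1]
            polynomial_map_mono[OF polynomial_map_monomial max.cobounded2]])
    then show ?thesis by blast
  qed
  then obtain e where "polynomial_map e F" by blast
  then have "polynomial_map e (\<lambda>x. h ^ e * F x)" by (rule polynomial_map_mult)
  moreover have "h ^ e * F (of_nat n) = 0" if "n \<le> e" for n
  proof -
    have "h ^ e * F (of_nat n) = h ^ (e - n) * (h ^ n * F (of_nat n))"
      using that by (simp add: mult.assoc[symmetric] power_add[symmetric])
    then show ?thesis by (simp add: hF)
  qed
  ultimately have F0: "h ^ e * F x = 0" for x by (rule polynomial_map_eq_0)
  define P where "P n r = (\<Sum>k\<le>m. scale ((- of_nat (n + 1)) ^ k) (\<delta> k r))" for n :: nat and r
  define \<epsilon> where "\<epsilon> n r = (\<Sum>k\<le>m. scale ((- of_nat (n + 1)) ^ k) (conj_op h t (\<delta> k) (- of_nat n) r))"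
    for n :: nat and r
  show ?thesis
  proof (rule that[OF b])
    show "P n \<in> carrier D" "\<epsilon> n \<in> carrier D" for n
      unfolding P_def[abs_def] \<epsilon>_def[abs_def]
      by (intro diffop_sum_closed diffop_scale_closed conj_op_diffop \<delta>; simp)+
    show "\<epsilon> n (h ^ n * r) = h ^ (n + t) * P n r" for n r
      by (simp add: \<epsilon>_def P_def sum_distrib_left conj_op_of_neg_nat[OF t] scale_mult_right)
    show "h ^ (e + 1) * \<epsilon> n 1 = scale (poly b (- of_nat (n + 1))) (h ^ (t + e))" for n
    proof -
      have "F (- of_nat (n + 1)) = h * \<epsilon> n 1 - scale (poly b (- of_nat (n + 1))) (h ^ t)"
        by (simp add: F_def \<epsilon>_def sum_distrib_left scale_mult_right)
      then have "h ^ e * (h * \<epsilon> n 1) = h ^ e * scale (poly b (- of_nat (n + 1))) (h ^ t)"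
        using F0[of "- of_nat (n + 1)"] by (simp only: right_diff_distrib eq_iff_diff_eq_0[symmetric])
      then show ?thesis by (simp only: scale_mult_right power_add power_one_right ac_simps)
    qed
  qed
qed

end

section \<open>Differential operators acting on a localization\<close>

locale multiplicative_set =
  fixes W :: "'r::comm_ring_1 set"
  assumes one_in [simp]: "1 \<in> W" and mult_in [simp]: "x \<in> W \<Longrightarrow> y \<in> W \<Longrightarrow> x * y \<in> W"
begin

abbreviation frac :: "'r \<Rightarrow> 'r \<Rightarrow> ('r \<times> 'r) set" where
  "frac \<equiv> loc_frac W"

lemma power_in [simp]: "x \<in> W \<Longrightarrow> x ^ n \<in> W"
  by (induction n) auto

lemma equiv_loc_rel: "equiv (UNIV \<times> W) (loc_rel W)"
proof (rule equivI)
  show "loc_rel W \<subseteq> (UNIV \<times> W) \<times> (UNIV \<times> W)" by (auto simp: loc_rel_def)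
  show "refl_on (UNIV \<times> W) (loc_rel W)"
    by (auto simp: refl_on_def loc_rel_def intro: bexI[of _ 1])
  show "sym (loc_rel W)"
  proof (rule symI)
    fix x y assume "(x, y) \<in> loc_rel W"
    then obtain r w r' w' t where *: "x = (r, w)" "y = (r', w')" "w \<in> W" "w' \<in> W" "t \<in> W"
      "t * (r * w' - r' * w) = 0" by (auto simp: loc_rel_def)
    have "t * (r' * w - r * w') = - (t * (r * w' - r' * w))" by (simp add: algebra_simps)
    with * show "(y, x) \<in> loc_rel W" by (auto simp: loc_rel_def)
  qed
  show "trans (loc_rel W)"
  proof (rule transI)
    fix x y z assume "(x, y) \<in> loc_rel W" "(y, z) \<in> loc_rel W"
    then obtain r w r' w' r'' w'' t s where *: "x = (r, w)" "y = (r', w')" "z = (r'', w'')"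
      "w \<in> W" "w' \<in> W" "w'' \<in> W" "t \<in> W" "s \<in> W"
      "t * (r * w' - r' * w) = 0" "s * (r' * w'' - r'' * w') = 0"
      by (fastforce simp: loc_rel_def)
    have "(t * s * w') * (r * w'' - r'' * w)
        = s * w'' * (t * (r * w' - r' * w)) + t * w * (s * (r' * w'' - r'' * w'))"
      by (simp add: algebra_simps)
    also have "\<dots> = 0" using * by simp
    finally show "(x, z) \<in> loc_rel W" using * unfolding loc_rel_def by auto
  qed
qed

lemma frac_eq_iff:
  assumes "w \<in> W" "w' \<in> W"
  shows "frac r w = frac r' w' \<longleftrightarrow> (\<exists>t\<in>W. t * (r * w' - r' * w) = 0)"
proof -
  have "frac r w = frac r' w' \<longleftrightarrow> ((r, w), (r', w')) \<in> loc_rel W"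
    unfolding loc_frac_def using assms by (intro eq_equiv_class_iff[OF equiv_loc_rel]) auto
  then show ?thesis using assms by (simp add: loc_rel_def)
qed

lemma frac_eqI:
  assumes "w \<in> W" "w' \<in> W" "t \<in> W" "t * (r * w') = t * (r' * w)"
  shows "frac r w = frac r' w'"
  using assms by (auto simp: frac_eq_iff right_diff_distrib)

lemma frac_cancel: "w \<in> W \<Longrightarrow> t \<in> W \<Longrightarrow> frac (t * r) (t * w) = frac r w"
  by (rule frac_eqI[of _ _ 1]) (simp_all add: ac_simps)

lemma frac_self: "w \<in> W \<Longrightarrow> (r, w) \<in> frac r w"
  by (auto simp: loc_frac_def loc_rel_def intro: bexI[of _ 1])

lemma frac_memD:
  assumes "(r, w) \<in> frac r' w'"
  shows "w \<in> W" "frac r w = frac r' w'"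
proof -
  have rel: "((r', w'), (r, w)) \<in> loc_rel W" using assms by (simp add: loc_frac_def)
  then show "w \<in> W" by (simp add: loc_rel_def)
  show "frac r w = frac r' w'"
    unfolding loc_frac_def by (rule equiv_class_eq[OF equiv_loc_rel rel, symmetric])
qed

text \<open>Operations on fractions are unions over all representatives; this evaluates them at one.\<close>

lemma UN_frac:
  assumes "w \<in> W" "\<And>a b. b \<in> W \<Longrightarrow> frac a b = frac r w \<Longrightarrow> F a b = F r w"
  shows "(\<Union>(a, b)\<in>frac r w. F a b) = F r w"
proof -
  have "(case x of (a, b) \<Rightarrow> F a b) = F r w" if "x \<in> frac r w" for x
    using that assms(2)[OF frac_memD] by (cases x) simp
  moreover have "frac r w \<noteq> {}" using frac_self[OF assms(1)] by blast
  ultimately show ?thesis by (metis (no_types, lifting) SUP_cong UN_constant)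
qed

lemma carrier_loc_ring: "carrier (loc_ring W) = {frac r w | r w. w \<in> W}"
  by (auto simp: loc_ring_def loc_frac_def quotient_def)

lemma loc_add_frac:
  assumes "w \<in> W" "w' \<in> W"
  shows "frac r w \<oplus>\<^bsub>loc_ring W\<^esub> frac r' w' = frac (r * w' + r' * w) (w * w')"
proof -
  have eq: "frac (a * b' + a' * b) (b * b') = frac (r * w' + r' * w) (w * w')"
    if b: "b \<in> W" "frac a b = frac r w" "b' \<in> W" "frac a' b' = frac r' w'" for a b a' b'
  proof -
    obtain t s where ts: "t \<in> W" "s \<in> W" "t * (a * w - r * b) = 0" "s * (a' * w' - r' * b') = 0"
      using b assms by (auto simp: frac_eq_iff)
    have "(t * s) * ((a * b' + a' * b) * (w * w') - (r * w' + r' * w) * (b * b'))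
        = s * b' * w' * (t * (a * w - r * b)) + t * b * w * (s * (a' * w' - r' * b'))"
      by (simp add: algebra_simps)
    also have "\<dots> = 0" using ts by simp
    finally show ?thesis using ts(1,2) b(1,3) assms by (subst frac_eq_iff) auto
  qed
  have inner: "(\<Union>(a', b')\<in>frac r' w'. frac (a * b' + a' * b) (b * b')) = frac (r * w' + r' * w) (w * w')"
    if "b \<in> W" "frac a b = frac r w" for a b
  proof -
    have "(\<Union>(a', b')\<in>frac r' w'. frac (a * b' + a' * b) (b * b')) = frac (a * w' + r' * b) (b * w')"
      by (rule UN_frac[OF assms(2)]) (simp only: eq[OF that] eq[OF that assms(2) refl])
    then show ?thesis by (simp only: eq[OF that assms(2) refl])
  qed
  have "(\<Union>(a, b)\<in>frac r w. \<Union>(a', b')\<in>frac r' w'. frac (a * b' + a' * b) (b * b'))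
      = (\<Union>(a', b')\<in>frac r' w'. frac (r * b' + a' * w) (w * b'))"
    by (rule UN_frac[OF assms(1)]) (simp only: inner inner[OF assms(1) refl])
  then show ?thesis
    by (simp only: inner[OF assms(1) refl]) (simp add: loc_ring_def)
qed

lemma loc_add_frac_same:
  assumes "w \<in> W" shows "frac r w \<oplus>\<^bsub>loc_ring W\<^esub> frac r' w = frac (r + r') w"
proof -
  have "r * w + r' * w = w * (r + r')" by (simp add: algebra_simps)
  then show ?thesis unfolding loc_add_frac[OF assms assms] using frac_cancel[OF assms assms] by simp
qed

lemma loc_zero_frac: "w \<in> W \<Longrightarrow> \<zero>\<^bsub>loc_ring W\<^esub> = frac 0 w"
  unfolding loc_ring_def ring_record_simps by (rule frac_eqI[of _ _ 1]) simp_all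

lemma common_denominator:
  assumes "u \<in> carrier (loc_ring W)" "v \<in> carrier (loc_ring W)"
  obtains r r' w where "w \<in> W" "u = frac r w" "v = frac r' w"
proof -
  obtain r w r' w' where "w \<in> W" "u = frac r w" "w' \<in> W" "v = frac r' w'"
    using assms by (auto simp: carrier_loc_ring)
  then show ?thesis
    using that[of "w' * w" "w' * r" "w * r'"] frac_cancel[of w w' r] frac_cancel[of w' w r']
    by (simp add: mult.commute)
qed

lemma abelian_group_loc_ring: "abelian_group (loc_ring W)"
proof (rule abelian_groupI)
  fix x y assume xy: "x \<in> carrier (loc_ring W)" "y \<in> carrier (loc_ring W)"
  then obtain r r' w where w: "w \<in> W" "x = frac r w" "y = frac r' w"
    by (rule common_denominator)
  then show "x \<oplus>\<^bsub>loc_ring W\<^esub> y \<in> carrier (loc_ring W)"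
    by (auto simp: loc_add_frac_same carrier_loc_ring)
  show "x \<oplus>\<^bsub>loc_ring W\<^esub> y = y \<oplus>\<^bsub>loc_ring W\<^esub> x"
    using w by (simp add: loc_add_frac_same add.commute)
  show "\<zero>\<^bsub>loc_ring W\<^esub> \<oplus>\<^bsub>loc_ring W\<^esub> x = x"
    using w by (simp add: loc_zero_frac[of w] loc_add_frac_same)
  show "\<exists>y\<in>carrier (loc_ring W). y \<oplus>\<^bsub>loc_ring W\<^esub> x = \<zero>\<^bsub>loc_ring W\<^esub>"
    using w by (intro bexI[of _ "frac (- r) w"])
      (auto simp: loc_zero_frac[of w] loc_add_frac_same carrier_loc_ring)
  fix z assume "z \<in> carrier (loc_ring W)"
  then obtain s v where v: "v \<in> W" "z = frac s v" by (auto simp: carrier_loc_ring)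
  have *: "x = frac (v * r) (v * w)" "y = frac (v * r') (v * w)" "z = frac (w * s) (v * w)"
    using w v frac_cancel[of v w s] frac_cancel[of w v] by (simp_all add: mult.commute)
  show "x \<oplus>\<^bsub>loc_ring W\<^esub> y \<oplus>\<^bsub>loc_ring W\<^esub> z = x \<oplus>\<^bsub>loc_ring W\<^esub> (y \<oplus>\<^bsub>loc_ring W\<^esub> z)"
    using w(1) v(1) unfolding * by (simp add: loc_add_frac_same add.assoc)
qed (auto simp: carrier_loc_ring loc_zero_frac[of 1] intro: one_in)

lemma finsum_frac:
  assumes "finite A" "w \<in> W"
  shows "(\<Oplus>\<^bsub>loc_ring W\<^esub>a\<in>A. frac (c a) w) = frac (\<Sum>a\<in>A. c a) w"
proof -
  interpret L: abelian_group "loc_ring W" by (rule abelian_group_loc_ring)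
  show ?thesis
    using assms(1)
  proof (induction A rule: finite_induct)
    case empty
    show ?case using loc_zero_frac[OF assms(2)] by simp
  next
    case (insert a A)
    have "frac (c b) w \<in> carrier (loc_ring W)" for b
      using assms(2) by (auto simp: carrier_loc_ring)
    then show ?case using insert by (simp add: L.finsum_insert loc_add_frac_same[OF assms(2)])
  qed
qed

end

locale diffop_localization = algebra_char_0 scale + multiplicative_set W
  for scale :: "'k::field_char_0 \<Rightarrow> 'r::comm_ring_1 \<Rightarrow> 'r" and W :: "'r set"
begin

abbreviation L :: "('r \<Rightarrow> 'r, ('r \<times> 'r) set) module" where
  "L \<equiv> loc_module scale W"

lemma L_simps:
  "carrier L = {frac r w | r w. w \<in> W}"
  "w \<in> W \<Longrightarrow> w' \<in> W \<Longrightarrow> frac r w \<oplus>\<^bsub>L\<^esub> frac r' w' = frac (r * w' + r' * w) (w * w')"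
  "w \<in> W \<Longrightarrow> frac r w \<oplus>\<^bsub>L\<^esub> frac r' w = frac (r + r') w"
  using loc_add_frac loc_add_frac_same by (simp_all add: loc_module_def carrier_loc_ring)



lemma frac_in_L [simp]: "w \<in> W \<Longrightarrow> frac r w \<in> carrier L"
  by (auto simp: L_simps)

lemma L_common_denominator:
  assumes "u \<in> carrier L" "v \<in> carrier L"
  obtains r r' w where "w \<in> W" "u = frac r w" "v = frac r' w"
  using assms by (auto simp: loc_module_def intro: common_denominator)

lemma abelian_group_L: "abelian_group L"
proof -
  interpret abelian_group "loc_ring W" by (rule abelian_group_loc_ring)
  have eqs: "carrier L = carrier (loc_ring W)" "\<zero>\<^bsub>L\<^esub> = \<zero>\<^bsub>loc_ring W\<^esub>"
    "u \<oplus>\<^bsub>L\<^esub> v = u \<oplus>\<^bsub>loc_ring W\<^esub> v" for u v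
    by (simp_all add: loc_module_def)
  show ?thesis
    by (rule abelian_groupI) (auto simp: eqs a_ac intro: l_neg bexI[of _ "\<ominus>\<^bsub>loc_ring W\<^esub> _"])
qed

text \<open>Here \<open>\<zeta>\<close> inverts a larger denominator \<open>a g\<close> than \<open>\<epsilon>\<close> does. Both \<open>z \<epsilon>\<close> and \<open>w \<zeta> a\<close> become
  \<open>w z \<delta>\<close> after composition with \<open>g\<close>, so they agree up to a power of \<open>g\<close>.\<close>

lemma frac_ore_refine:
  assumes "\<epsilon> \<in> carrier D" "\<zeta> \<in> carrier D" "g \<in> W" "w \<in> W" "z \<in> W"
    and \<epsilon>: "\<And>x. \<epsilon> (g * x) = w * \<delta> x" and \<zeta>: "\<And>x. \<zeta> (a * (g * x)) = z * \<delta> x"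
  shows "frac (\<epsilon> r) w = frac (\<zeta> (a * r)) z"
proof -
  define \<theta> where "\<theta> x = z * \<epsilon> x + (- w) * \<zeta> (a * x)" for x
  have "\<theta> \<in> carrier D"
    unfolding \<theta>_def[abs_def]
    by (intro diffop_add_closed[OF alg] diffop_mult_closed diffop_comp_closed[OF _ mult_in_diffop] assms)
  moreover have "\<theta> (g * x) = 0" for x by (simp add: \<theta>_def \<epsilon> \<zeta> ac_simps)
  ultimately obtain n where "g ^ n * \<theta> r = 0" using diffop_right_cancel[of \<theta> g] by metis
  then show ?thesis
    using assms(3-5) by (intro frac_eqI[of _ _ "g ^ n"]) (simp_all add: \<theta>_def algebra_simps)
qed

text \<open>Independence of the representative \<open>r/g\<close> and of the Ore relation: compare both sides with a
  relation for the common denominator \<open>t g g'\<close>.\<close>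

lemma frac_ore_unique:
  assumes \<delta>: "\<delta> \<in> carrier D" and \<epsilon>: "\<epsilon> \<in> carrier D" "\<epsilon>' \<in> carrier D"
    and W: "g \<in> W" "w \<in> W" "g' \<in> W" "w' \<in> W"
    and eq: "\<And>x. \<epsilon> (g * x) = w * \<delta> x" "\<And>x. \<epsilon>' (g' * x) = w' * \<delta> x"
    and frac: "frac r g = frac r' g'"
  shows "frac (\<epsilon> r) w = frac (\<epsilon>' r') w'"
proof -
  obtain t where t: "t \<in> W" "t * (r * g') = t * (r' * g)"
    using frac W by (auto simp: frac_eq_iff right_diff_distrib)
  obtain \<zeta> n where \<zeta>: "\<zeta> \<in> carrier D" "\<And>x. \<zeta> (t * g * g' * x) = (t * g * g') ^ n * \<delta> x"
    using diffop_ore[OF \<delta>] by blast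
  let ?z = "(t * g * g') ^ n"
  have "frac (\<epsilon> r) w = frac (\<zeta> (t * g' * r)) ?z"
    by (rule frac_ore_refine[OF \<epsilon>(1) \<zeta>(1) W(1,2) _ eq(1)])
      (use \<zeta>(2) t W in \<open>simp_all add: ac_simps\<close>)
  also have "t * g' * r = t * g * r'" using t(2) by (simp add: ac_simps)
  also have "frac (\<zeta> (t * g * r')) ?z = frac (\<epsilon>' r') w'"
    by (rule frac_ore_refine[OF \<epsilon>(2) \<zeta>(1) W(3,4) _ eq(2), symmetric])
      (use \<zeta>(2) t W in \<open>simp_all add: ac_simps\<close>)
  finally show ?thesis .
qed

lemma conj_op_minus_one:
  "conj_op g t \<delta> (- 1) r = (\<Sum>j\<le>t. g ^ (t - j) * ((- 1) ^ j * iter_comm \<delta> g j r))"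
proof -
  have "scale ((- 1) ^ j) y = (- 1) ^ j * y" for j y
    by (cases "even j") simp_all
  moreover have "(- 1 :: 'k) gchoose j = (- 1) ^ j" for j
    using gbinomial_minus[of "1 :: 'k" j] by (simp add: binomial_gbinomial[symmetric])
  ultimately show ?thesis
    by (simp add: conj_op_def mult.left_commute)
qed

text \<open>The alternating sum that defines the action on \<open>r/g\<close> is \<open>conj_op g t \<delta> (-1) r / g\<^sup>t\<^sup>+\<^sup>1\<close>, which is
  the special case of the Ore relation \<open>conj_op g t \<delta> (-1) g = g\<^sup>t\<^sup>+\<^sup>1 \<delta>\<close>. By uniqueness any other Ore
  relation gives the same fraction. This replaces the defining sum in everything that follows.\<close>

lemma smult_frac:
  assumes \<delta>: "\<delta> \<in> carrier D" and \<epsilon>: "\<epsilon> \<in> carrier D" and W: "g \<in> W" "w \<in> W"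
    and eq: "\<And>x. \<epsilon> (g * x) = w * \<delta> x"
  shows "\<delta> \<odot>\<^bsub>L\<^esub> frac r g = frac (\<epsilon> r) w"
proof -
  interpret Lr: abelian_group "loc_ring W" by (rule abelian_group_loc_ring)
  define t where "t = diffop_order scale \<delta>"
  have t: "\<delta> \<in> diffop_le scale t"
    using \<delta> unfolding t_def diffop_order_def in_diffop_iff by (rule LeastI_ex)
  define F where "F a b = (\<Oplus>\<^bsub>loc_ring W\<^esub>j\<in>{..t}. frac ((- 1) ^ j * iter_comm \<delta> b j a) (b ^ (j + 1)))"
    for a b
  have F: "F a b = frac (conj_op b t \<delta> (- 1) a) (b ^ (1 + t))" if b: "b \<in> W" for a b
  proof -
    have "F a b = (\<Oplus>\<^bsub>loc_ring W\<^esub>j\<in>{..t}.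
        frac (b ^ (t - j) * ((- 1) ^ j * iter_comm \<delta> b j a)) (b ^ (1 + t)))"
      unfolding F_def
    proof (rule Lr.finsum_cong')
      fix j assume "j \<in> {..t}"
      then have "1 + t = (t - j) + (j + 1)" by simp
      then have "b ^ (1 + t) = b ^ (t - j) * b ^ (j + 1)" by (simp only: power_add[symmetric])
      then show "frac ((- 1) ^ j * iter_comm \<delta> b j a) (b ^ (j + 1))
          = frac (b ^ (t - j) * ((- 1) ^ j * iter_comm \<delta> b j a)) (b ^ (1 + t))"
        using frac_cancel[of "b ^ (j + 1)" "b ^ (t - j)" "(- 1) ^ j * iter_comm \<delta> b j a"] b
        by simp
    next
      have "b ^ (1 + t) \<in> W" using b by (rule power_in)
      then show "(\<lambda>j. frac (b ^ (t - j) * ((- 1) ^ j * iter_comm \<delta> b j a)) (b ^ (1 + t)))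
          \<in> {..t} \<rightarrow> carrier (loc_ring W)"
        unfolding carrier_loc_ring by blast
    qed simp
    then show ?thesis
      using b by (simp only: finsum_frac[OF finite_atMost power_in] conj_op_minus_one)
  qed
  have F': "F a b = frac (\<epsilon> r) w" if b: "b \<in> W" "frac a b = frac r g" for a b
    unfolding F[OF b(1)]
    by (rule frac_ore_unique[OF \<delta> conj_op_diffop[OF \<delta>] \<epsilon> b(1) _ W _ eq b(2)])
      (use conj_op_of_neg_nat[OF t, of b 1] b W in simp_all)
  have "\<delta> \<odot>\<^bsub>L\<^esub> frac r g = (\<Union>(a, b)\<in>frac r g. F a b)"
    by (simp add: loc_module_def t_def F_def)
  also have "\<dots> = F r g"
    by (rule UN_frac[OF W(1)]) (simp add: F' W)
  finally show ?thesis by (simp add: F' W)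
qed

lemma smult_mult_frac: "g \<in> W \<Longrightarrow> (\<lambda>x. a * x) \<odot>\<^bsub>L\<^esub> frac r g = frac (a * r) g"
  by (rule smult_frac[OF mult_in_diffop mult_in_diffop]) (simp_all add: mult.left_commute)

lemma obtain_ore:
  assumes "\<delta> \<in> carrier D" "g \<in> W"
  obtains \<epsilon> w where "\<epsilon> \<in> carrier D" "w \<in> W" "\<And>x. \<epsilon> (g * x) = w * \<delta> x"
  using diffop_ore[OF assms(1), of g] assms(2) power_in by metis

text \<open>Ore relations can be added over a common left factor, and composed: \<open>\<zeta> g = z \<eta>\<close> and
  \<open>\<epsilon>' z = w' \<delta>\<close> give \<open>\<epsilon>' \<zeta> g = w' \<delta> \<eta>\<close>.\<close>

lemma left_module_L: "left_module D L"
proof -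
  interpret D: ring D by (rule ring_diffop_ring[OF alg])
  interpret L: abelian_group L by (rule abelian_group_L)
  have add_def: "\<delta> \<oplus>\<^bsub>D\<^esub> \<eta> = (\<lambda>x. \<delta> x + \<eta> x)" and mult_def: "\<delta> \<otimes>\<^bsub>D\<^esub> \<eta> = (\<lambda>x. \<delta> (\<eta> x))"
    and one_def: "\<one>\<^bsub>D\<^esub> = (\<lambda>x. 1 * x)" for \<delta> \<eta>
    by (auto simp: diffop_ring_def)
  show ?thesis
  proof unfold_locales
    fix \<delta> u assume \<delta>: "\<delta> \<in> carrier D" and "u \<in> carrier L"
    then obtain r g where u: "u = frac r g" "g \<in> W" by (auto simp: L_simps)
    obtain \<epsilon> w where \<epsilon>: "\<epsilon> \<in> carrier D" "w \<in> W" "\<And>x. \<epsilon> (g * x) = w * \<delta> x"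
      using obtain_ore[OF \<delta> u(2)] by metis
    then show "\<delta> \<odot>\<^bsub>L\<^esub> u \<in> carrier L"
      using smult_frac[OF \<delta> \<epsilon>(1) u(2) \<epsilon>(2,3)] u by simp
  next
    fix \<delta> \<eta> u assume \<delta>: "\<delta> \<in> carrier D" "\<eta> \<in> carrier D" and "u \<in> carrier L"
    then obtain r g where u: "u = frac r g" and g: "g \<in> W" by (auto simp: L_simps)
    obtain \<epsilon> w where \<epsilon>: "\<epsilon> \<in> carrier D" "w \<in> W" "\<And>x. \<epsilon> (g * x) = w * \<delta> x"
      using obtain_ore[OF \<delta>(1) g] by metis
    obtain \<zeta> z where \<zeta>: "\<zeta> \<in> carrier D" "z \<in> W" "\<And>x. \<zeta> (g * x) = z * \<eta> x"
      using obtain_ore[OF \<delta>(2) g] by metis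
    have "(\<lambda>x. \<delta> x + \<eta> x) \<odot>\<^bsub>L\<^esub> frac r g = frac (z * \<epsilon> r + w * \<zeta> r) (w * z)"
    proof (rule smult_frac[where \<epsilon> = "\<lambda>x. z * \<epsilon> x + w * \<zeta> x"])
      show "(\<lambda>x. \<delta> x + \<eta> x) \<in> carrier D" "(\<lambda>x. z * \<epsilon> x + w * \<zeta> x) \<in> carrier D"
        by (intro diffop_add_closed[OF alg] diffop_mult_closed \<delta> \<epsilon> \<zeta>)+
      show "z * \<epsilon> (g * x) + w * \<zeta> (g * x) = w * z * (\<delta> x + \<eta> x)" for x
        unfolding \<epsilon> \<zeta> by (simp add: algebra_simps)
    qed (use g \<epsilon> \<zeta> in auto)
    then show "(\<delta> \<oplus>\<^bsub>D\<^esub> \<eta>) \<odot>\<^bsub>L\<^esub> u = \<delta> \<odot>\<^bsub>L\<^esub> u \<oplus>\<^bsub>L\<^esub> \<eta> \<odot>\<^bsub>L\<^esub> u"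
      using smult_frac[OF \<delta>(1) \<epsilon>(1) g \<epsilon>(2,3), of r] smult_frac[OF \<delta>(2) \<zeta>(1) g \<zeta>(2,3), of r] \<epsilon>(2) \<zeta>(2)
      by (simp add: u add_def L_simps mult.commute)
    obtain \<epsilon>' w' where \<epsilon>': "\<epsilon>' \<in> carrier D" "w' \<in> W" "\<And>x. \<epsilon>' (z * x) = w' * \<delta> x"
      using obtain_ore[OF \<delta>(1) \<zeta>(2)] by metis
    have "(\<lambda>x. \<delta> (\<eta> x)) \<odot>\<^bsub>L\<^esub> frac r g = frac (\<epsilon>' (\<zeta> r)) w'"
      by (rule smult_frac[OF diffop_comp_closed[OF \<delta>] diffop_comp_closed[OF \<epsilon>'(1) \<zeta>(1)] g \<epsilon>'(2)])
        (simp only: \<epsilon>' \<zeta>)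
    then show "(\<delta> \<otimes>\<^bsub>D\<^esub> \<eta>) \<odot>\<^bsub>L\<^esub> u = \<delta> \<odot>\<^bsub>L\<^esub> (\<eta> \<odot>\<^bsub>L\<^esub> u)"
      using smult_frac[OF \<delta>(2) \<zeta>(1) g \<zeta>(2,3), of r] smult_frac[OF \<delta>(1) \<epsilon>'(1) \<zeta>(2) \<epsilon>'(2,3), of "\<zeta> r"]
      by (simp add: u mult_def)
  next
    fix \<delta> u v assume \<delta>: "\<delta> \<in> carrier D" and "u \<in> carrier L" "v \<in> carrier L"
    then obtain r r' g where g: "g \<in> W" "u = frac r g" "v = frac r' g"
      using L_common_denominator by blast
    obtain \<epsilon> w where \<epsilon>: "\<epsilon> \<in> carrier D" "w \<in> W" "\<And>x. \<epsilon> (g * x) = w * \<delta> x"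
      using obtain_ore[OF \<delta> g(1)] by metis
    then show "\<delta> \<odot>\<^bsub>L\<^esub> (u \<oplus>\<^bsub>L\<^esub> v) = \<delta> \<odot>\<^bsub>L\<^esub> u \<oplus>\<^bsub>L\<^esub> \<delta> \<odot>\<^bsub>L\<^esub> v"
      using g by (simp add: L_simps(3) smult_frac[OF \<delta> \<epsilon>(1) g(1) \<epsilon>(2,3)] diffop_add[OF \<epsilon>(1)])
  next
    fix u assume "u \<in> carrier L"
    then obtain r g where g: "g \<in> W" "u = frac r g" by (auto simp: L_simps)
    show "\<one>\<^bsub>D\<^esub> \<odot>\<^bsub>L\<^esub> u = u"
      using smult_mult_frac[OF g(1), of 1 r] unfolding one_def g(2) mult_1[of r] .
  qed
qed

end

lemma multiplicative_set_powers_of: "multiplicative_set (powers_of g)"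
  by unfold_locales
    (auto simp: powers_of_def power_add[symmetric] intro: range_eqI[of _ _ 0])

text \<open>The generator is \<open>1/h\<^sup>m\<close>, where no \<open>-(n+1)\<close> with \<open>n \<ge> m\<close> is a root of \<open>b\<close>.\<close>

lemma (in algebra_char_0) localization_cyclic:
  assumes "admits_bernstein_sato scale h"
  obtains m where "\<And>u. u \<in> carrier (loc_module scale (powers_of h)) \<Longrightarrow>
    \<exists>\<delta>\<in>carrier D. u = \<delta> \<odot>\<^bsub>loc_module scale (powers_of h)\<^esub> loc_frac (powers_of h) 1 (h ^ m)"
proof -
  interpret diffop_localization scale "powers_of h"
    by (intro diffop_localization.intro algebra_char_0_axioms multiplicative_set_powers_of)
  interpret L: left_module D L by (rule left_module_L)
  have pow [simp]: "h ^ n \<in> powers_of h" for n by (simp add: powers_of_def)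
  have comp: "(\<delta> \<otimes>\<^bsub>D\<^esub> \<eta>) = (\<lambda>x. \<delta> (\<eta> x))" for \<delta> \<eta> by (auto simp: diffop_ring_def)
  obtain b :: "'k poly" and P \<epsilon> t e where b: "b \<noteq> 0"
    and P: "\<And>n. P n \<in> carrier D" and \<epsilon>: "\<And>n. \<epsilon> n \<in> carrier D"
    and ore: "\<And>n r. \<epsilon> n (h ^ n * r) = h ^ (n + t) * P n r"
    and eq: "\<And>n. h ^ (e + 1) * \<epsilon> n 1 = scale (poly b (- of_nat (n + 1))) (h ^ (t + e))"
    using bernstein_sato_at_negative_integers[OF assms] by blast
  have "inj (\<lambda>n::nat. - of_nat (n + 1) :: 'k)" by (auto simp: inj_on_def)
  then have "finite {n::nat. poly b (- of_nat (n + 1)) = 0}"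
    using finite_vimageI[OF poly_roots_finite[OF b], of "\<lambda>n::nat. - of_nat (n + 1)"]
    by (simp add: vimage_def)
  then obtain m where m: "\<And>n. n \<in> {n::nat. poly b (- of_nat (n + 1)) = 0} \<Longrightarrow> n < m"
    using finite_nat_bounded by blast
  have step: "\<exists>\<delta>\<in>carrier D. frac 1 (h ^ (n + 1)) = \<delta> \<odot>\<^bsub>L\<^esub> frac 1 (h ^ n)" if "m \<le> n" for n
  proof -
    define \<beta> where "\<beta> = poly b (- of_nat (n + 1))"
    have \<beta>: "\<beta> \<noteq> 0" using m[of n] that unfolding \<beta>_def by fastforce
    let ?c = "scale (1 / \<beta>) 1"
    have "(\<lambda>x. ?c * P n x) \<odot>\<^bsub>L\<^esub> frac 1 (h ^ n) = frac (?c * \<epsilon> n 1) (h ^ (n + t))"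
      by (rule smult_frac[where \<epsilon> = "\<lambda>x. ?c * \<epsilon> n x"])
        (auto simp: ore P \<epsilon> mult.left_commute intro: diffop_mult_closed)
    also have "\<dots> = frac 1 (h ^ (n + 1))"
    proof (rule frac_eqI[of _ _ "h ^ e"])
      have "h ^ e * (?c * \<epsilon> n 1 * h ^ (n + 1)) = h ^ n * (?c * (h ^ (e + 1) * \<epsilon> n 1))"
        by (simp add: algebra_simps power_add)
      also have "\<dots> = h ^ n * h ^ (t + e)"
        using \<beta> by (simp only: eq \<beta>_def[symmetric] scale_mult_left mult_1 V.scale_scale) simp
      also have "\<dots> = h ^ e * (1 * h ^ (n + t))" by (simp add: power_add[symmetric] ac_simps)
      finally show "h ^ e * (?c * \<epsilon> n 1 * h ^ (n + 1)) = h ^ e * (1 * h ^ (n + t))" .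
    qed (simp_all del: power_Suc power_Suc2 add: pow)
    finally show ?thesis using diffop_mult_closed[OF P[of n], of ?c] by metis
  qed
  have gen: "\<exists>\<delta>\<in>carrier D. frac 1 (h ^ (m + n)) = \<delta> \<odot>\<^bsub>L\<^esub> frac 1 (h ^ m)" for n
  proof (induction n)
    case 0
    show ?case by (intro bexI[of _ "\<one>\<^bsub>D\<^esub>"]) (simp_all add: L.smult_one)
  next
    case (Suc n)
    then obtain \<delta> \<eta> where "\<delta> \<in> carrier D" "frac 1 (h ^ (m + n)) = \<delta> \<odot>\<^bsub>L\<^esub> frac 1 (h ^ m)"
      "\<eta> \<in> carrier D" "frac 1 (h ^ (m + Suc n)) = \<eta> \<odot>\<^bsub>L\<^esub> frac 1 (h ^ (m + n))"
      using step[of "m + n"] by auto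
    then show ?case by (intro bexI[of _ "\<eta> \<otimes>\<^bsub>D\<^esub> \<delta>"]) (simp_all add: L.smult_assoc)
  qed
  show ?thesis
  proof (rule that)
    fix u assume "u \<in> carrier L"
    then obtain r w where w: "w \<in> powers_of h" "u = frac r w" by (auto simp: L_simps)
    obtain n where n: "w = h ^ n" using w(1) unfolding powers_of_def by blast
    note u = w(2)[unfolded n]
    obtain \<delta> where \<delta>: "\<delta> \<in> carrier D" "frac 1 (h ^ (m + n)) = \<delta> \<odot>\<^bsub>L\<^esub> frac 1 (h ^ m)" using gen by blast
    let ?\<mu> = "\<lambda>x. (r * h ^ m) * x"
    have "u = frac (r * h ^ m) (h ^ (m + n))"
      using frac_cancel[of "h ^ n" "h ^ m" r] by (simp add: u power_add mult.commute)
    also have "\<dots> = ?\<mu> \<odot>\<^bsub>L\<^esub> (\<delta> \<odot>\<^bsub>L\<^esub> frac 1 (h ^ m))"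
      unfolding \<delta>(2)[symmetric] by (subst smult_mult_frac) simp_all
    also have "\<dots> = (?\<mu> \<otimes>\<^bsub>D\<^esub> \<delta>) \<odot>\<^bsub>L\<^esub> frac 1 (h ^ m)"
      by (rule L.smult_assoc[symmetric]) (simp_all add: \<delta> mult_in_diffop)
    finally show "\<exists>\<delta>\<in>carrier D. u = \<delta> \<odot>\<^bsub>L\<^esub> frac 1 (h ^ m)"
      using L.A.m_closed[OF mult_in_diffop \<delta>(1)] by blast
  qed
qed

section \<open>Noetherian left modules\<close>

context left_module
begin

lemma smult_zero_right: "a \<in> carrier A \<Longrightarrow> a \<odot>\<^bsub>M\<^esub> \<zero>\<^bsub>M\<^esub> = \<zero>\<^bsub>M\<^esub>"
  using smult_r_distr[of a "\<zero>\<^bsub>M\<^esub>" "\<zero>\<^bsub>M\<^esub>"] smult_closed[of a "\<zero>\<^bsub>M\<^esub>"] M.add.l_cancel_one by simp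

lemma smult_zero_left: "x \<in> carrier M \<Longrightarrow> \<zero>\<^bsub>A\<^esub> \<odot>\<^bsub>M\<^esub> x = \<zero>\<^bsub>M\<^esub>"
  using smult_l_distr[of "\<zero>\<^bsub>A\<^esub>" "\<zero>\<^bsub>A\<^esub>" x] smult_closed[of "\<zero>\<^bsub>A\<^esub>" x] M.add.l_cancel_one by simp

lemma minus_eq_smult:
  assumes "x \<in> carrier M" shows "\<ominus>\<^bsub>M\<^esub> x = (\<ominus>\<^bsub>A\<^esub> \<one>\<^bsub>A\<^esub>) \<odot>\<^bsub>M\<^esub> x"
proof (rule M.minus_equality)
  have "(\<ominus>\<^bsub>A\<^esub> \<one>\<^bsub>A\<^esub>) \<odot>\<^bsub>M\<^esub> x \<oplus>\<^bsub>M\<^esub> x = (\<ominus>\<^bsub>A\<^esub> \<one>\<^bsub>A\<^esub> \<oplus>\<^bsub>A\<^esub> \<one>\<^bsub>A\<^esub>) \<odot>\<^bsub>M\<^esub> x"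
    using assms by (simp add: smult_l_distr smult_one)
  then show "(\<ominus>\<^bsub>A\<^esub> \<one>\<^bsub>A\<^esub>) \<odot>\<^bsub>M\<^esub> x \<oplus>\<^bsub>M\<^esub> x = \<zero>\<^bsub>M\<^esub>"
    using assms by (simp add: A.l_neg smult_zero_left)
qed (use assms in \<open>simp_all add: smult_closed\<close>)

text \<open>Closure under negation comes for free, as it is multiplication by \<open>-1\<close>.\<close>

lemma submodule_iff:
  "submodule N A M \<longleftrightarrow> N \<subseteq> carrier M \<and> \<zero>\<^bsub>M\<^esub> \<in> N \<and> (\<forall>x\<in>N. \<forall>y\<in>N. x \<oplus>\<^bsub>M\<^esub> y \<in> N) \<and>
     (\<forall>a\<in>carrier A. \<forall>x\<in>N. a \<odot>\<^bsub>M\<^esub> x \<in> N)" (is "_ \<longleftrightarrow> ?R")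
proof
  assume "submodule N A M"
  then interpret submodule N A M .
  show ?R using subset m_closed one_closed smult_closed by auto
next
  assume R: ?R
  have "\<ominus>\<^bsub>M\<^esub> x \<in> N" if "x \<in> N" for x
    using R that minus_eq_smult[of x] by auto
  then show "submodule N A M"
    using R by (intro submodule.intro subgroup.intro submodule_axioms.intro)
      (auto simp: a_inv_def)
qed

lemma submodule_diff:
  assumes "submodule N A M" "x \<in> N" "y \<in> N" shows "x \<ominus>\<^bsub>M\<^esub> y \<in> N"
  using assms minus_eq_smult[of y] unfolding submodule_iff a_minus_def by auto

lemma submodule_Int: "submodule N A M \<Longrightarrow> submodule N' A M \<Longrightarrow> submodule (N \<inter> N') A M"
  unfolding submodule_iff by auto

end

definition noetherian_left_module ::
  "('a, 'm) ring_scheme \<Rightarrow> ('a, 'b, 'n) module_scheme \<Rightarrow> bool" where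
  "noetherian_left_module A M \<longleftrightarrow> left_module A M \<and>
     (\<forall>N. submodule N A M \<longrightarrow>
        (\<exists>S. finite S \<and> S \<subseteq> N \<and> (\<forall>N'. submodule N' A M \<longrightarrow> S \<subseteq> N' \<longrightarrow> N \<subseteq> N')))"

lemma noetherian_left_moduleE:
  assumes "noetherian_left_module A M" "submodule N A M"
  obtains S where "finite S" "S \<subseteq> N" "\<And>N'. submodule N' A M \<Longrightarrow> S \<subseteq> N' \<Longrightarrow> N \<subseteq> N'"
  using assms unfolding noetherian_left_module_def by meson

text \<open>Submodules of \<open>A x\<close> correspond to the left ideals of those \<open>a\<close> that send \<open>x\<close> into them.\<close>

lemma (in left_module) noetherian_if_cyclic:
  assumes noeth: "left_right_noetherian A" and x: "x \<in> carrier M"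
    and gen: "\<And>u. u \<in> carrier M \<Longrightarrow> \<exists>a\<in>carrier A. u = a \<odot>\<^bsub>M\<^esub> x"
  shows "noetherian_left_module A M"
proof -
  have ideal: "left_ideal {a \<in> carrier A. a \<odot>\<^bsub>M\<^esub> x \<in> N} A" if N: "submodule N A M" for N
  proof -
    note N' = N[unfolded submodule_iff]
    have "\<ominus>\<^bsub>A\<^esub> a \<odot>\<^bsub>M\<^esub> x \<in> N" if "a \<in> carrier A" "a \<odot>\<^bsub>M\<^esub> x \<in> N" for a
    proof -
      have "\<ominus>\<^bsub>A\<^esub> a = \<ominus>\<^bsub>A\<^esub> \<one>\<^bsub>A\<^esub> \<otimes>\<^bsub>A\<^esub> a" using that(1) by (simp add: A.l_minus)
      then show ?thesis using that N' x by (simp add: smult_assoc)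
    qed
    then show ?thesis
      unfolding left_ideal_def using N' x
      by (intro conjI additive_subgroup.intro subgroup.intro)
        (auto simp: smult_l_distr smult_assoc smult_zero_left a_inv_def[symmetric])
  qed
  show ?thesis
    unfolding noetherian_left_module_def
  proof (intro conjI allI impI)
    show "left_module A M" by (rule left_module_axioms)
    fix N assume N: "submodule N A M"
    obtain S where S: "finite S" "S \<subseteq> {a \<in> carrier A. a \<odot>\<^bsub>M\<^esub> x \<in> N}"
      "\<And>J. left_ideal J A \<Longrightarrow> S \<subseteq> J \<Longrightarrow> {a \<in> carrier A. a \<odot>\<^bsub>M\<^esub> x \<in> N} \<subseteq> J"
      using noeth ideal[OF N] unfolding left_right_noetherian_def by meson
    show "\<exists>S. finite S \<and> S \<subseteq> N \<and> (\<forall>N'. submodule N' A M \<longrightarrow> S \<subseteq> N' \<longrightarrow> N \<subseteq> N')"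
    proof (intro exI[of _ "(\<lambda>a. a \<odot>\<^bsub>M\<^esub> x) ` S"] conjI allI impI)
      fix N' assume N': "submodule N' A M" "(\<lambda>a. a \<odot>\<^bsub>M\<^esub> x) ` S \<subseteq> N'"
      have sub: "{a \<in> carrier A. a \<odot>\<^bsub>M\<^esub> x \<in> N} \<subseteq> {a \<in> carrier A. a \<odot>\<^bsub>M\<^esub> x \<in> N'}"
        using S(2) N'(2) by (intro S(3)[OF ideal[OF N'(1)]]) auto
      show "N \<subseteq> N'"
      proof
        fix u assume u: "u \<in> N"
        then obtain a where "a \<in> carrier A" "u = a \<odot>\<^bsub>M\<^esub> x"
          using gen N unfolding submodule_iff by blast
        then show "u \<in> N'" using sub u by auto
      qed
    qed (use S in auto)
  qed
qed

definition prod_module ::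
  "'i set \<Rightarrow> ('i \<Rightarrow> ('a, 'b, 'n) module_scheme) \<Rightarrow> ('a, 'i \<Rightarrow> 'b) module" where
  "prod_module I M =
     \<lparr>carrier = (\<Pi>\<^sub>E i\<in>I. carrier (M i)), monoid.mult = undefined, one = undefined,
      ring.zero = (\<lambda>i\<in>I. \<zero>\<^bsub>M i\<^esub>), add = (\<lambda>c c'. \<lambda>i\<in>I. c i \<oplus>\<^bsub>M i\<^esub> c' i),
      module.smult = (\<lambda>a c. \<lambda>i\<in>I. a \<odot>\<^bsub>M i\<^esub> c i)\<rparr>"

lemma left_module_prod_module:
  assumes "ring A" "\<And>i. i \<in> I \<Longrightarrow> left_module A (M i)"
  shows "left_module A (prod_module I M)"
proof -
  note lm = left_module.smult_closed[OF assms(2)] left_module.smult_l_distr[OF assms(2)]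
    left_module.smult_r_distr[OF assms(2)] left_module.smult_assoc[OF assms(2)]
    left_module.smult_one[OF assms(2)]
  have ag: "abelian_group (M i)" if "i \<in> I" for i
    using assms(2)[OF that] by (simp add: left_module_def)
  note am = abelian_group.axioms(1)[OF ag]
  note agr = abelian_monoid.a_closed[OF am] abelian_monoid.a_assoc[OF am]
    abelian_monoid.zero_closed[OF am] abelian_monoid.l_zero[OF am]
    abelian_group.a_inv_closed[OF ag] abelian_group.l_neg[OF ag]
  have "abelian_group (prod_module I M)"
  proof (rule abelian_groupI)
    fix x assume x: "x \<in> carrier (prod_module I M)"
    show "\<exists>y\<in>carrier (prod_module I M). y \<oplus>\<^bsub>prod_module I M\<^esub> x = \<zero>\<^bsub>prod_module I M\<^esub>"
      using x by (intro bexI[of _ "\<lambda>i\<in>I. \<ominus>\<^bsub>M i\<^esub> x i"])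
        (auto simp: prod_module_def PiE_iff agr intro!: restrict_ext)
  next
    fix x y assume "x \<in> carrier (prod_module I M)" "y \<in> carrier (prod_module I M)"
    then show "x \<oplus>\<^bsub>prod_module I M\<^esub> y = y \<oplus>\<^bsub>prod_module I M\<^esub> x"
      using abelian_monoid.a_comm[OF am]
      by (auto simp: prod_module_def PiE_iff intro!: restrict_ext)
  qed (auto simp: prod_module_def PiE_iff agr extensional_def fun_eq_iff)
  then show ?thesis
    using assms(1)
    by (intro left_module.intro left_module_axioms.intro)
      (auto simp: prod_module_def PiE_iff lm agr extensional_def fun_eq_iff
        ring.ring_simprules ring.is_monoid monoid.one_closed)
qed

text \<open>Induction over the set \<open>T\<close> of coordinates on which the elements of a submodule \<open>N\<close> may be
  nonzero. To add a coordinate \<open>j\<close>, combine elements whose \<open>j\<close>-th coordinates generate the projection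
  of \<open>N\<close> with generators of the kernel of that projection.\<close>

lemma noetherian_prod_module:
  assumes "finite I" "ring A" and noeth: "\<And>i. i \<in> I \<Longrightarrow> noetherian_left_module A (M i)"
  shows "noetherian_left_module A (prod_module I M)"
proof -
  let ?P = "prod_module I M"
  have lmi: "left_module A (M i)" if "i \<in> I" for i
    using noeth[OF that] by (simp add: noetherian_left_module_def)
  interpret P: left_module A ?P by (rule left_module_prod_module[OF assms(2) lmi])
  have P_simps: "x i \<in> carrier (M i)" "\<zero>\<^bsub>?P\<^esub> i = \<zero>\<^bsub>M i\<^esub>" "(x \<oplus>\<^bsub>?P\<^esub> y) i = x i \<oplus>\<^bsub>M i\<^esub> y i"
    "(a \<odot>\<^bsub>?P\<^esub> x) i = a \<odot>\<^bsub>M i\<^esub> x i" if "x \<in> carrier ?P" "i \<in> I" for x y a i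
    using that by (auto simp: prod_module_def PiE_iff)
  have "\<exists>S. finite S \<and> S \<subseteq> N \<and> (\<forall>N'. submodule N' A ?P \<longrightarrow> S \<subseteq> N' \<longrightarrow> N \<subseteq> N')"
    if "finite T" "T \<subseteq> I" "submodule N A ?P" "\<And>x i. x \<in> N \<Longrightarrow> i \<in> I - T \<Longrightarrow> x i = \<zero>\<^bsub>M i\<^esub>" for T N
    using that
  proof (induction T arbitrary: N rule: finite_induct)
    case empty
    have "x = \<zero>\<^bsub>?P\<^esub>" if "x \<in> N" for x
    proof -
      have "x \<in> carrier ?P" using empty(2) that unfolding P.submodule_iff by blast
      then have "x \<in> extensional I" by (simp add: prod_module_def PiE_iff)
      then show ?thesis
        using empty(3)[OF that] by (auto simp: prod_module_def extensional_def fun_eq_iff)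
    qed
    then have "N \<subseteq> N'" if "submodule N' A ?P" for N' using that unfolding P.submodule_iff by auto
    then show ?case by (intro exI[of _ "{}"]) auto
  next
    case (insert j T)
    then have j: "j \<in> I" by simp
    interpret j: left_module A "M j" by (rule lmi[OF j])
    have proj: "submodule ((\<lambda>x. x j) ` K) A (M j)" if "submodule K A ?P" for K
      unfolding j.submodule_iff
    proof (intro conjI ballI)
      note K = that[unfolded P.submodule_iff]
      show "(\<lambda>x. x j) ` K \<subseteq> carrier (M j)" using K P_simps(1)[OF _ j] by blast
      show "\<zero>\<^bsub>M j\<^esub> \<in> (\<lambda>x. x j) ` K" using K P_simps(2)[OF P.M.zero_closed j] by (metis image_eqI)
      show "u \<oplus>\<^bsub>M j\<^esub> v \<in> (\<lambda>x. x j) ` K"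
        if uv: "u \<in> (\<lambda>x. x j) ` K" "v \<in> (\<lambda>x. x j) ` K" for u v
      proof -
        obtain x y where "x \<in> K" "y \<in> K" "u = x j" "v = y j" using uv by auto
        then show ?thesis
          using K P_simps(3)[of x j y] j by (intro image_eqI[of _ _ "x \<oplus>\<^bsub>?P\<^esub> y"]) auto
      qed
      show "a \<odot>\<^bsub>M j\<^esub> u \<in> (\<lambda>x. x j) ` K"
        if au: "a \<in> carrier A" "u \<in> (\<lambda>x. x j) ` K" for a u
      proof -
        obtain x where "x \<in> K" "u = x j" using au by auto
        then show ?thesis
          using K P_simps(4)[of x j a] j au(1) by (intro image_eqI[of _ _ "a \<odot>\<^bsub>?P\<^esub> x"]) auto
      qed
    qed
    note N = insert.prems(2)[unfolded P.submodule_iff]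
    obtain S' where S': "finite S'" "S' \<subseteq> (\<lambda>x. x j) ` N"
      "\<And>K. submodule K A (M j) \<Longrightarrow> S' \<subseteq> K \<Longrightarrow> (\<lambda>x. x j) ` N \<subseteq> K"
      using noetherian_left_moduleE[OF noeth[OF j] proj[OF insert.prems(2)]] by metis
    obtain S1 where S1: "finite S1" "S1 \<subseteq> N" "S' = (\<lambda>x. x j) ` S1"
      using finite_subset_image[OF S'(1,2)] by blast
    define N0 where "N0 = {x \<in> N. x j = \<zero>\<^bsub>M j\<^esub>}"
    have N0: "submodule N0 A ?P"
      unfolding P.submodule_iff
    proof (intro conjI ballI)
      show "N0 \<subseteq> carrier ?P" using N by (auto simp: N0_def)
      show "\<zero>\<^bsub>?P\<^esub> \<in> N0" using N P_simps(2)[OF P.M.zero_closed j] by (simp add: N0_def)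
      show "x \<oplus>\<^bsub>?P\<^esub> y \<in> N0" if "x \<in> N0" "y \<in> N0" for x y
      proof -
        have "x \<in> carrier ?P" using that N by (auto simp: N0_def)
        then show ?thesis using that N P_simps(3)[of x j y] j by (simp add: N0_def)
      qed
      show "a \<odot>\<^bsub>?P\<^esub> x \<in> N0" if "a \<in> carrier A" "x \<in> N0" for a x
      proof -
        have "x \<in> carrier ?P" using that N by (auto simp: N0_def)
        then show ?thesis using that N P_simps(4)[of x j a] j by (simp add: N0_def j.smult_zero_right)
      qed
    qed
    have "x i = \<zero>\<^bsub>M i\<^esub>" if "x \<in> N0" "i \<in> I - T" for x i
      using insert.prems(3)[of x i] that by (cases "i = j") (auto simp: N0_def)
    then obtain S2 where S2: "finite S2" "S2 \<subseteq> N0"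
      "\<And>N'. submodule N' A ?P \<Longrightarrow> S2 \<subseteq> N' \<Longrightarrow> N0 \<subseteq> N'"
      using insert.IH[OF _ N0] insert.prems(1) by auto
    have "N \<subseteq> N'" if N': "submodule N' A ?P" "S1 \<union> S2 \<subseteq> N'" for N'
    proof
      fix x assume x: "x \<in> N"
      have sub: "submodule (N \<inter> N') A ?P" by (rule P.submodule_Int[OF insert.prems(2) N'(1)])
      have "S' \<subseteq> (\<lambda>x. x j) ` (N \<inter> N')" using S1 N'(2) by auto
      then have "x j \<in> (\<lambda>x. x j) ` (N \<inter> N')" using S'(3)[OF proj[OF sub]] x by blast
      then obtain y where y: "y \<in> N" "y \<in> N'" "x j = y j" by auto
      have c: "x \<in> carrier ?P" "y \<in> carrier ?P" using x y N by auto
      have "(x \<ominus>\<^bsub>?P\<^esub> y) j = \<zero>\<^bsub>M j\<^esub>"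
        using P_simps(1)[OF c(1) j] P_simps(1)[OF c(2) j]
        by (simp add: a_minus_def P.minus_eq_smult[OF c(2)] P_simps(3)[OF c(1) j] P_simps(4)[OF c(2) j]
            y(3) j.minus_eq_smult[symmetric] j.M.r_neg)
      then have "x \<ominus>\<^bsub>?P\<^esub> y \<in> N0"
        using P.submodule_diff[OF insert.prems(2) x y(1)] by (simp add: N0_def)
      then have "x \<ominus>\<^bsub>?P\<^esub> y \<in> N'" using S2(3)[OF N'(1)] N'(2) by blast
      then have "(x \<ominus>\<^bsub>?P\<^esub> y) \<oplus>\<^bsub>?P\<^esub> y \<in> N'" using N'(1) y unfolding P.submodule_iff by blast
      then show "x \<in> N'" using c by (simp add: a_minus_def P.M.a_assoc P.M.l_neg)
    qed
    moreover have "finite (S1 \<union> S2)" "S1 \<union> S2 \<subseteq> N" using S1 S2 by (auto simp: N0_def)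
    ultimately show ?case by blast
  qed
  from this[OF assms(1) subset_refl] show ?thesis
    unfolding noetherian_left_module_def using P.left_module_axioms by auto
qed

text \<open>In a \<open>subquotient M Z B\<close> with \<open>B\<close> a submodule, the coset operations are those induced by
  \<open>M\<close>: the union that defines the action runs over equal cosets.\<close>

lemma subquotient_simps:
  assumes "left_module A M" and B: "submodule B A M"
  shows subquotient_carrier: "carrier (subquotient M Z B) = (\<lambda>z. B +>\<^bsub>M\<^esub> z) ` Z"
    and subquotient_add: "x \<in> carrier M \<Longrightarrow> y \<in> carrier M \<Longrightarrow>
      (B +>\<^bsub>M\<^esub> x) \<oplus>\<^bsub>subquotient M Z B\<^esub> (B +>\<^bsub>M\<^esub> y) = B +>\<^bsub>M\<^esub> (x \<oplus>\<^bsub>M\<^esub> y)"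
    and subquotient_zero: "\<zero>\<^bsub>subquotient M Z B\<^esub> = B +>\<^bsub>M\<^esub> \<zero>\<^bsub>M\<^esub>"
    and subquotient_smult: "a \<in> carrier A \<Longrightarrow> x \<in> carrier M \<Longrightarrow>
      a \<odot>\<^bsub>subquotient M Z B\<^esub> (B +>\<^bsub>M\<^esub> x) = B +>\<^bsub>M\<^esub> (a \<odot>\<^bsub>M\<^esub> x)"
    and subquotient_eq_zero_iff: "x \<in> carrier M \<Longrightarrow>
      B +>\<^bsub>M\<^esub> x = \<zero>\<^bsub>subquotient M Z B\<^esub> \<longleftrightarrow> x \<in> B"
proof -
  interpret left_module A M by fact
  interpret B: abelian_subgroup B M
    using B abelian_subgroupI3 additive_subgroup.intro M.abelian_group_axioms
    by (metis submodule.axioms(1))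
  note B' = B[unfolded submodule_iff]
  let ?Q = "subquotient M Z B" and ?c = "\<lambda>z. B +>\<^bsub>M\<^esub> z"
  show "carrier ?Q = ?c ` Z" by (simp add: subquotient_def)
  show "?c x \<oplus>\<^bsub>?Q\<^esub> ?c y = ?c (x \<oplus>\<^bsub>M\<^esub> y)" if "x \<in> carrier M" "y \<in> carrier M" for x y
    using B.a_rcos_sum[OF that] by (simp add: subquotient_def)
  show "\<zero>\<^bsub>?Q\<^esub> = ?c \<zero>\<^bsub>M\<^esub>"
    using B.a_subset by (simp add: subquotient_def)
  show "?c x = \<zero>\<^bsub>?Q\<^esub> \<longleftrightarrow> x \<in> B" if "x \<in> carrier M" for x
    using B.a_rcos_self[OF that] B.a_rcos_const[of x] by (auto simp: subquotient_def)
  show "a \<odot>\<^bsub>?Q\<^esub> ?c x = ?c (a \<odot>\<^bsub>M\<^esub> x)" if a: "a \<in> carrier A" and x: "x \<in> carrier M" for a x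
  proof -
    have eq: "?c (a \<odot>\<^bsub>M\<^esub> z) = ?c (a \<odot>\<^bsub>M\<^esub> x)" if z: "z \<in> ?c x" for z
    proof -
      obtain b where b: "b \<in> B" "z = b \<oplus>\<^bsub>M\<^esub> x" using z unfolding a_r_coset_def' by blast
      then have "b \<in> carrier M" using B' by blast
      then have "a \<odot>\<^bsub>M\<^esub> z = a \<odot>\<^bsub>M\<^esub> b \<oplus>\<^bsub>M\<^esub> a \<odot>\<^bsub>M\<^esub> x" using b a x by (simp add: smult_r_distr)
      moreover have "a \<odot>\<^bsub>M\<^esub> b \<in> B" using B' a b by blast
      ultimately have "a \<odot>\<^bsub>M\<^esub> z \<in> ?c (a \<odot>\<^bsub>M\<^esub> x)" by (auto simp: a_r_coset_def')
      then show ?thesis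
        using B.a_repr_independence' smult_closed[OF a x] by metis
    qed
    have "a \<odot>\<^bsub>?Q\<^esub> ?c x = (\<Union>z\<in>?c x. ?c (a \<odot>\<^bsub>M\<^esub> z))" by (simp add: subquotient_def)
    also have "\<dots> = (\<Union>z\<in>?c x. ?c (a \<odot>\<^bsub>M\<^esub> x))" by (rule SUP_cong[OF refl eq])
    also have "\<dots> = ?c (a \<odot>\<^bsub>M\<^esub> x)" using B.a_rcos_self[OF x] by blast
    finally show ?thesis .
  qed
qed

lemma fin_gen_subquotient:
  assumes noeth: "noetherian_left_module A M" and Z: "submodule Z A M" and B: "submodule B A M"
  shows "fin_gen_left_module A (subquotient M Z B)"
proof -
  interpret left_module A M using noeth by (simp add: noetherian_left_module_def)
  note Z' = Z[unfolded submodule_iff]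
  let ?Q = "subquotient M Z B" and ?c = "\<lambda>z. B +>\<^bsub>M\<^esub> z"
  have ZM: "z \<in> carrier M" if "z \<in> Z" for z using that Z' by blast
  note carr = subquotient_carrier[OF left_module_axioms B, of Z]
    and add = subquotient_add[OF left_module_axioms B, where Z = Z]
    and zero = subquotient_zero[OF left_module_axioms B, of Z]
    and smult = subquotient_smult[OF left_module_axioms B, where Z = Z]
  have lm: "left_module A ?Q"
  proof (intro left_module.intro left_module_axioms.intro)
    show "ring A" by (rule A.ring_axioms)
    show "abelian_group ?Q"
    proof (rule abelian_groupI)
      fix x assume "x \<in> carrier ?Q"
      then obtain z where z: "z \<in> Z" "x = ?c z" by (auto simp: carr)
      have "\<ominus>\<^bsub>M\<^esub> z \<in> Z" using Z' minus_eq_smult[OF ZM[OF z(1)]] z by simp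
      then show "\<exists>y\<in>carrier ?Q. y \<oplus>\<^bsub>?Q\<^esub> x = \<zero>\<^bsub>?Q\<^esub>"
        using z ZM by (intro bexI[of _ "?c (\<ominus>\<^bsub>M\<^esub> z)"]) (auto simp: carr add zero M.l_neg)
    qed (use Z' in \<open>auto simp: carr add zero ZM M.a_ac\<close>)
  qed (use Z' in \<open>auto simp: carr add smult ZM smult_l_distr smult_r_distr smult_assoc smult_one smult_closed\<close>)
  obtain S where S: "finite S" "S \<subseteq> Z" "\<And>N. submodule N A M \<Longrightarrow> S \<subseteq> N \<Longrightarrow> Z \<subseteq> N"
    using noetherian_left_moduleE[OF noeth Z] by metis
  have "N = carrier ?Q" if N: "submodule N A ?Q" "?c ` S \<subseteq> N" for N
  proof -
    note N' = N(1)[unfolded left_module.submodule_iff[OF lm]]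
    have "submodule {z \<in> Z. ?c z \<in> N} A M"
      unfolding submodule_iff
    proof (intro conjI ballI)
      show "\<zero>\<^bsub>M\<^esub> \<in> {z \<in> Z. ?c z \<in> N}" using Z' N' zero by simp
      show "x \<oplus>\<^bsub>M\<^esub> y \<in> {z \<in> Z. ?c z \<in> N}" if "x \<in> {z \<in> Z. ?c z \<in> N}" "y \<in> {z \<in> Z. ?c z \<in> N}" for x y
      proof -
        have "?c x \<oplus>\<^bsub>?Q\<^esub> ?c y \<in> N" using that N' by blast
        then show ?thesis using that Z' ZM by (simp add: add)
      qed
      show "a \<odot>\<^bsub>M\<^esub> x \<in> {z \<in> Z. ?c z \<in> N}" if "a \<in> carrier A" "x \<in> {z \<in> Z. ?c z \<in> N}" for a x
      proof -
        have "a \<odot>\<^bsub>?Q\<^esub> ?c x \<in> N" using that N' by blast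
        then show ?thesis using that Z' ZM by (simp add: smult)
      qed
    qed (use ZM in auto)
    then have "Z \<subseteq> {z \<in> Z. ?c z \<in> N}" using S(2) N(2) by (intro S(3)) auto
    then show ?thesis using N' by (auto simp: carr)
  qed
  then show ?thesis
    unfolding fin_gen_left_module_def using lm S(1,2)
    by (intro conjI exI[of _ "?c ` S"]) (auto simp: carr)
qed

lemma zero_submodule: "left_module A M \<Longrightarrow> submodule {\<zero>\<^bsub>M\<^esub>} A M"
proof -
  assume "left_module A M"
  then interpret left_module A M .
  show ?thesis by (auto simp: submodule_iff smult_zero_right)
qed

lemma submodule_kernel_image:
  assumes "left_module A M" "left_module A M'"
    and closed: "\<And>x. x \<in> carrier M \<Longrightarrow> f x \<in> carrier M'"
    and add: "\<And>x y. x \<in> carrier M \<Longrightarrow> y \<in> carrier M \<Longrightarrow> f (x \<oplus>\<^bsub>M\<^esub> y) = f x \<oplus>\<^bsub>M'\<^esub> f y"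
    and smult: "\<And>a x. a \<in> carrier A \<Longrightarrow> x \<in> carrier M \<Longrightarrow> f (a \<odot>\<^bsub>M\<^esub> x) = a \<odot>\<^bsub>M'\<^esub> f x"
  shows "submodule (a_kernel M M' f) A M" "submodule (f ` carrier M) A M'"
proof -
  interpret M: left_module A M by fact
  interpret M': left_module A M' by fact
  have zero: "f \<zero>\<^bsub>M\<^esub> = \<zero>\<^bsub>M'\<^esub>"
    using smult[of "\<zero>\<^bsub>A\<^esub>" "\<zero>\<^bsub>M\<^esub>"] closed by (simp add: M.smult_zero_left M'.smult_zero_left)
  show "submodule (a_kernel M M' f) A M"
    unfolding M.submodule_iff a_kernel_def'
    by (auto simp: add smult zero M.smult_closed M'.smult_zero_right)
  show "submodule (f ` carrier M) A M'"
    unfolding M'.submodule_iff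
  proof (intro conjI ballI)
    show "f ` carrier M \<subseteq> carrier M'" using closed by auto
    show "\<zero>\<^bsub>M'\<^esub> \<in> f ` carrier M" using zero[symmetric] by auto
    show "u \<oplus>\<^bsub>M'\<^esub> v \<in> f ` carrier M" if "u \<in> f ` carrier M" "v \<in> f ` carrier M" for u v
      using that by (auto simp: add[symmetric])
    show "a \<odot>\<^bsub>M'\<^esub> u \<in> f ` carrier M" if "a \<in> carrier A" "u \<in> f ` carrier M" for a u
      using that by (auto simp: smult[symmetric] M.smult_closed)
  qed
qed

section \<open>The Cech complex\<close>

context left_module
begin

lemma smult_minus_right:
  assumes "a \<in> carrier A" "x \<in> carrier M"
  shows "a \<odot>\<^bsub>M\<^esub> (\<ominus>\<^bsub>M\<^esub> x) = \<ominus>\<^bsub>M\<^esub> (a \<odot>\<^bsub>M\<^esub> x)"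
proof (rule M.minus_equality[symmetric])
  show "a \<odot>\<^bsub>M\<^esub> (\<ominus>\<^bsub>M\<^esub> x) \<oplus>\<^bsub>M\<^esub> a \<odot>\<^bsub>M\<^esub> x = \<zero>\<^bsub>M\<^esub>"
    using assms by (simp add: smult_r_distr[symmetric] M.l_neg smult_zero_right)
qed (use assms in \<open>simp_all add: smult_closed\<close>)

lemma smult_finsum:
  assumes "a \<in> carrier A" "finite K" "\<And>k. k \<in> K \<Longrightarrow> x k \<in> carrier M"
  shows "a \<odot>\<^bsub>M\<^esub> (\<Oplus>\<^bsub>M\<^esub>k\<in>K. x k) = (\<Oplus>\<^bsub>M\<^esub>k\<in>K. a \<odot>\<^bsub>M\<^esub> x k)"
  using assms(2,3)
proof (induction K rule: finite_induct)
  case empty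
  show ?case using assms(1) by (simp add: smult_zero_right)
next
  case (insert k K)
  have "(\<Oplus>\<^bsub>M\<^esub>k\<in>K. x k) \<in> carrier M" using insert by (intro M.finsum_closed) auto
  then show ?case
    using insert assms(1) by (simp add: M.finsum_insert smult_r_distr smult_closed Pi_def)
qed

end

lemma (in algebra_char_0) diffop_localization_powers_of: "diffop_localization scale (powers_of g)"
  by (intro diffop_localization.intro algebra_char_0_axioms multiplicative_set_powers_of)

text \<open>All representatives of a fraction over \<open>g\<close> have the same image, so the union in \<open>loc_map\<close>
  is the image of any one of them.\<close>

lemma loc_map_frac:
  "loc_map g h (loc_frac (powers_of g) r (g ^ n)) = loc_frac (powers_of (g * h)) (r * h ^ n) ((g * h) ^ n)"
proof -
  interpret G: multiplicative_set "powers_of g" by (rule multiplicative_set_powers_of)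
  interpret GH: multiplicative_set "powers_of (g * h)" by (rule multiplicative_set_powers_of)
  have [simp]: "g ^ m \<in> powers_of g" "(g * h) ^ m \<in> powers_of (g * h)" for m
    by (simp_all add: powers_of_def)
  have eq: "GH.frac (r' * h ^ m) ((g * h) ^ m) = GH.frac (r * h ^ n) ((g * h) ^ n)"
    if rm: "(r', g ^ m) \<in> G.frac r (g ^ n)" for r' m
  proof -
    obtain t where "t \<in> powers_of g" "t * (r' * g ^ n - r * g ^ m) = 0"
      using G.frac_memD(2)[OF rm] by (auto simp: G.frac_eq_iff)
    then obtain k where k: "g ^ k * (r' * g ^ n - r * g ^ m) = 0" by (auto simp: powers_of_def)
    have "(g * h) ^ k * (r' * h ^ m * (g * h) ^ n - r * h ^ n * (g * h) ^ m)
        = h ^ k * h ^ m * h ^ n * (g ^ k * (r' * g ^ n - r * g ^ m))"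
      by (simp add: power_mult_distrib algebra_simps)
    then have "(g * h) ^ k * (r' * h ^ m * (g * h) ^ n - r * h ^ n * (g * h) ^ m) = 0"
      by (simp only: k mult_zero_right)
    then show ?thesis by (subst GH.frac_eq_iff) auto
  qed
  have "{GH.frac (r' * h ^ m) ((g * h) ^ m) | r' m. (r', g ^ m) \<in> G.frac r (g ^ n)}
      = {GH.frac (r * h ^ n) ((g * h) ^ n)}" (is "?X = _")
  proof
    show "?X \<subseteq> {GH.frac (r * h ^ n) ((g * h) ^ n)}" using eq by blast
    have "(r, g ^ n) \<in> G.frac r (g ^ n)" by (rule G.frac_self) simp
    then show "{GH.frac (r * h ^ n) ((g * h) ^ n)} \<subseteq> ?X" by blast
  qed
  then show ?thesis by (simp add: loc_map_def)
qed

text \<open>Additivity is clear over a common denominator. For \<open>D\<close>-linearity, an Ore relation over \<open>g\<^sup>n\<close> in the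
  source and one over \<open>(g h)\<^sup>n\<close> in the target are related by cancelling \<open>g\<^sup>n\<close> on the right.\<close>

lemma (in algebra_char_0) loc_map_hom:
  fixes g h
  defines "L \<equiv> loc_module scale (powers_of g)" and "L' \<equiv> loc_module scale (powers_of (g * h))"
  shows "u \<in> carrier L \<Longrightarrow> loc_map g h u \<in> carrier L'"
    and "u \<in> carrier L \<Longrightarrow> v \<in> carrier L \<Longrightarrow>
      loc_map g h (u \<oplus>\<^bsub>L\<^esub> v) = loc_map g h u \<oplus>\<^bsub>L'\<^esub> loc_map g h v"
    and "\<delta> \<in> carrier D \<Longrightarrow> u \<in> carrier L \<Longrightarrow>
      loc_map g h (\<delta> \<odot>\<^bsub>L\<^esub> u) = \<delta> \<odot>\<^bsub>L'\<^esub> loc_map g h u"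
proof -
  interpret G: diffop_localization scale "powers_of g" by (rule diffop_localization_powers_of)
  interpret GH: diffop_localization scale "powers_of (g * h)" by (rule diffop_localization_powers_of)
  have pow [simp]: "g ^ m \<in> powers_of g" "(g * h) ^ m \<in> powers_of (g * h)" for m
    by (simp_all add: powers_of_def)
  have powE: "\<exists>n. w = g ^ n" if "w \<in> powers_of g" for w using that by (auto simp: powers_of_def)
  show "loc_map g h u \<in> carrier L'" if u: "u \<in> carrier L" for u
  proof -
    obtain r w where "u = G.frac r w" "w \<in> powers_of g"
      using u unfolding L_def G.L_simps(1) by blast
    then obtain n where "u = G.frac r (g ^ n)" using powE by blast
    then show ?thesis by (simp add: loc_map_frac L'_def)
  qed
  show "loc_map g h (u \<oplus>\<^bsub>L\<^esub> v) = loc_map g h u \<oplus>\<^bsub>L'\<^esub> loc_map g h v"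
    if uv: "u \<in> carrier L" "v \<in> carrier L" for u v
  proof -
    obtain r r' w where "w \<in> powers_of g" "u = G.frac r w" "v = G.frac r' w"
      using uv unfolding L_def by (rule G.L_common_denominator)
    then obtain n where "u = G.frac r (g ^ n)" "v = G.frac r' (g ^ n)" using powE by blast
    then show ?thesis
      by (simp add: L_def L'_def G.L_simps(3) GH.L_simps(3) loc_map_frac distrib_right)
  qed
  show "loc_map g h (\<delta> \<odot>\<^bsub>L\<^esub> u) = \<delta> \<odot>\<^bsub>L'\<^esub> loc_map g h u"
    if \<delta>: "\<delta> \<in> carrier D" and u: "u \<in> carrier L" for \<delta> u
  proof -
    obtain r w where "u = G.frac r w" "w \<in> powers_of g"
      using u unfolding L_def G.L_simps(1) by blast
    then obtain n where u': "u = G.frac r (g ^ n)" using powE by blast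
    obtain \<epsilon> w where \<epsilon>0: "\<epsilon> \<in> carrier D" "w \<in> powers_of g" "\<And>x. \<epsilon> (g ^ n * x) = w * \<delta> x"
      using G.obtain_ore[OF \<delta> pow(1)[of n]] by metis
    obtain m where m: "w = g ^ m" using powE[OF \<epsilon>0(2)] by blast
    note \<epsilon> = \<epsilon>0(1) \<epsilon>0(3)[unfolded m]
    obtain \<zeta> z where \<zeta>: "\<zeta> \<in> carrier D" "z \<in> powers_of (g * h)"
      "\<And>x. \<zeta> ((g * h) ^ n * x) = z * \<delta> x"
      using GH.obtain_ore[OF \<delta> pow(2)[of n]] by metis
    have lhs: "loc_map g h (\<delta> \<odot>\<^bsub>L\<^esub> u) = GH.frac (\<epsilon> r * h ^ m) ((g * h) ^ m)"
      using G.smult_frac[OF \<delta> \<epsilon>(1) pow(1)[of n] pow(1)[of m] \<epsilon>(2), of r]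
      by (simp add: L_def u' loc_map_frac)
    have rhs: "\<delta> \<odot>\<^bsub>L'\<^esub> loc_map g h u = GH.frac (\<zeta> (r * h ^ n)) z"
      using GH.smult_frac[OF \<delta> \<zeta>(1) pow(2)[of n] \<zeta>(2,3), of "r * h ^ n"]
      by (simp add: L'_def u' loc_map_frac)
    \<comment> \<open>Both summands become \<open>g\<^sup>m z \<delta>\<close>, up to sign, after composition with \<open>g\<^sup>n\<close>.\<close>
    define \<theta> where "\<theta> x = z * \<epsilon> x + (- (g ^ m)) * \<zeta> (h ^ n * x)" for x
    have "\<theta> \<in> carrier D"
      unfolding \<theta>_def[abs_def]
      by (intro diffop_add_closed[OF alg] diffop_mult_closed diffop_comp_closed[OF _ mult_in_diffop]
          \<epsilon>(1) \<zeta>(1))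
    moreover have "\<theta> (g ^ n * x) = 0" for x
    proof -
      have "h ^ n * (g ^ n * x) = (g * h) ^ n * x" by (simp add: power_mult_distrib ac_simps)
      then show ?thesis unfolding \<theta>_def \<epsilon>(2) by (simp only: \<zeta>(3)) (simp add: ac_simps)
    qed
    ultimately obtain k where "(g ^ n) ^ k * \<theta> r = 0" using diffop_right_cancel[of \<theta> "g ^ n"] by metis
    then have k: "(g ^ n) ^ k * (z * \<epsilon> r) = (g ^ n) ^ k * (g ^ m * \<zeta> (r * h ^ n))"
      by (simp add: \<theta>_def algebra_simps)
    show ?thesis
      unfolding lhs rhs
    proof (rule GH.frac_eqI[OF pow(2) \<zeta>(2) GH.power_in[OF pow(2)[of n], of k]])
      have "((g * h) ^ n) ^ k * (\<epsilon> r * h ^ m * z) = (h ^ n) ^ k * h ^ m * ((g ^ n) ^ k * (z * \<epsilon> r))"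
        by (simp add: power_mult_distrib ac_simps)
      also have "\<dots> = ((g * h) ^ n) ^ k * (\<zeta> (r * h ^ n) * (g * h) ^ m)"
        unfolding k by (simp add: power_mult_distrib ac_simps)
      finally show "((g * h) ^ n) ^ k * (\<epsilon> r * h ^ m * z)
        = ((g * h) ^ n) ^ k * (\<zeta> (r * h ^ n) * (g * h) ^ m)" .
    qed
  qed
qed

lemma cech_module_eq_prod_module: "cech_module scale fs i = prod_module (cech_index fs i) (cech_loc scale fs)"
  by (simp add: cech_module_def prod_module_def)

lemma finite_cech_index: "finite (cech_index fs i)"
  by (rule finite_subset[of _ "Pow {..<length fs}"]) (auto simp: cech_index_def)

lemma cech_index_remove:
  assumes "J \<in> cech_index fs (Suc i)" "k \<in> J"
  shows "J - {k} \<in> cech_index fs i" "cech_prod fs J = cech_prod fs (J - {k}) * fs ! k"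
proof -
  have "finite J" using assms by (auto simp: cech_index_def intro: finite_subset)
  then show "J - {k} \<in> cech_index fs i" "cech_prod fs J = cech_prod fs (J - {k}) * fs ! k"
    using assms by (auto simp: cech_index_def cech_prod_def prod.remove mult.commute)
qed

context algebra_char_0
begin

lemma left_module_cech_loc: "left_module D (cech_loc scale fs J)"
  using diffop_localization.left_module_L[OF diffop_localization_powers_of] .

lemma left_module_cech_module: "left_module D (cech_module scale fs i)"
  unfolding cech_module_eq_prod_module
  by (rule left_module_prod_module[OF ring_diffop_ring[OF alg] left_module_cech_loc])

lemma noetherian_cech_module:
  assumes bs: "has_bernstein_sato scale" and noeth: "left_right_noetherian D"
  shows "noetherian_left_module D (cech_module scale fs i)"
  unfolding cech_module_eq_prod_module
proof (rule noetherian_prod_module[OF finite_cech_index ring_diffop_ring[OF alg]])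
  fix J
  interpret diffop_localization scale "powers_of (cech_prod fs J)"
    by (rule diffop_localization_powers_of)
  have "admits_bernstein_sato scale (cech_prod fs J)"
    using bs by (simp add: has_bernstein_sato_def)
  then obtain m where m: "\<And>u. u \<in> carrier L \<Longrightarrow> \<exists>\<delta>\<in>carrier D. u = \<delta> \<odot>\<^bsub>L\<^esub> frac 1 (cech_prod fs J ^ m)"
    using localization_cyclic by metis
  have "cech_prod fs J ^ m \<in> powers_of (cech_prod fs J)" by (simp add: powers_of_def)
  then show "noetherian_left_module D L"
    by (intro left_module.noetherian_if_cyclic[OF left_module_L noeth _ m] frac_in_L)
qed

lemma cech_diff_hom:
  fixes fs :: "'r list" and i :: nat
  defines "C \<equiv> cech_module scale fs i" and "C' \<equiv> cech_module scale fs (Suc i)"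
  shows "c \<in> carrier C \<Longrightarrow> cech_diff scale fs i c \<in> carrier C'"
    and "c \<in> carrier C \<Longrightarrow> c' \<in> carrier C \<Longrightarrow>
      cech_diff scale fs i (c \<oplus>\<^bsub>C\<^esub> c') = cech_diff scale fs i c \<oplus>\<^bsub>C'\<^esub> cech_diff scale fs i c'"
    and "\<delta> \<in> carrier D \<Longrightarrow> c \<in> carrier C \<Longrightarrow>
      cech_diff scale fs i (\<delta> \<odot>\<^bsub>C\<^esub> c) = \<delta> \<odot>\<^bsub>C'\<^esub> cech_diff scale fs i c"
proof -
  define T where "T J c k = (let y = loc_map (cech_prod fs (J - {k})) (fs ! k) (c (J - {k}))
      in if even (card {j\<in>J. j < k}) then y else \<ominus>\<^bsub>cech_loc scale fs J\<^esub> y)" for J c k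
  have diff: "cech_diff scale fs i c = (\<lambda>J\<in>cech_index fs (Suc i). \<Oplus>\<^bsub>cech_loc scale fs J\<^esub>k\<in>J. T J c k)" for c
    by (simp add: cech_diff_def T_def)
  have fin: "finite J" if "J \<in> cech_index fs (Suc i)" for J
    using that by (auto simp: cech_index_def intro: finite_subset)
  have comp: "c I \<in> carrier (cech_loc scale fs I)" if "c \<in> carrier C" "I \<in> cech_index fs i" for c I
    using that by (auto simp: C_def cech_module_def)
  have T_closed: "T J c k \<in> carrier (cech_loc scale fs J)"
    and T_add: "T J (c \<oplus>\<^bsub>C\<^esub> c') k = T J c k \<oplus>\<^bsub>cech_loc scale fs J\<^esub> T J c' k"
    and T_smult: "\<delta> \<in> carrier D \<Longrightarrow> T J (\<delta> \<odot>\<^bsub>C\<^esub> c) k = \<delta> \<odot>\<^bsub>cech_loc scale fs J\<^esub> T J c k"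
    if J: "J \<in> cech_index fs (Suc i)" "k \<in> J" and c: "c \<in> carrier C" "c' \<in> carrier C" for J k c c' \<delta>
  proof -
    interpret J: left_module D "cech_loc scale fs J" by (rule left_module_cech_loc)
    note I = cech_index_remove(1)[OF J]
    note hom = loc_map_hom[where g = "cech_prod fs (J - {k})" and h = "fs ! k",
        folded cech_index_remove(2)[OF J]]
    have ops: "(c \<oplus>\<^bsub>C\<^esub> c') (J - {k}) = c (J - {k}) \<oplus>\<^bsub>cech_loc scale fs (J - {k})\<^esub> c' (J - {k})"
      "(\<delta> \<odot>\<^bsub>C\<^esub> c) (J - {k}) = \<delta> \<odot>\<^bsub>cech_loc scale fs (J - {k})\<^esub> c (J - {k})"
      using I by (simp_all add: C_def cech_module_def)
    note cI = comp[OF c(1) I] comp[OF c(2) I]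
    note cl = hom(1)[OF cI(1)] hom(1)[OF cI(2)]
    show "T J c k \<in> carrier (cech_loc scale fs J)"
      using cl by (simp add: T_def Let_def)
    show "T J (c \<oplus>\<^bsub>C\<^esub> c') k = T J c k \<oplus>\<^bsub>cech_loc scale fs J\<^esub> T J c' k"
      using cl by (simp add: T_def Let_def ops hom(2)[OF cI] J.M.minus_add)
    show "T J (\<delta> \<odot>\<^bsub>C\<^esub> c) k = \<delta> \<odot>\<^bsub>cech_loc scale fs J\<^esub> T J c k" if "\<delta> \<in> carrier D"
      using cl by (simp add: T_def Let_def ops hom(3)[OF that cI(1)] J.smult_minus_right[OF that])
  qed
  show closed: "cech_diff scale fs i c \<in> carrier C'" if "c \<in> carrier C" for c
  proof -
    have "(\<Oplus>\<^bsub>cech_loc scale fs J\<^esub>k\<in>J. T J c k) \<in> carrier (cech_loc scale fs J)"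
      if J: "J \<in> cech_index fs (Suc i)" for J
    proof -
      interpret J: left_module D "cech_loc scale fs J" by (rule left_module_cech_loc)
      show ?thesis by (rule J.M.finsum_closed) (use T_closed[OF J] \<open>c \<in> carrier C\<close> in auto)
    qed
    then show ?thesis by (simp add: diff C'_def cech_module_def)
  qed
  show "cech_diff scale fs i (c \<oplus>\<^bsub>C\<^esub> c') = cech_diff scale fs i c \<oplus>\<^bsub>C'\<^esub> cech_diff scale fs i c'"
    if c: "c \<in> carrier C" "c' \<in> carrier C" for c c'
  proof -
    have "(\<Oplus>\<^bsub>cech_loc scale fs J\<^esub>k\<in>J. T J (c \<oplus>\<^bsub>C\<^esub> c') k)
        = (\<Oplus>\<^bsub>cech_loc scale fs J\<^esub>k\<in>J. T J c k) \<oplus>\<^bsub>cech_loc scale fs J\<^esub> (\<Oplus>\<^bsub>cech_loc scale fs J\<^esub>k\<in>J. T J c' k)"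
      if J: "J \<in> cech_index fs (Suc i)" for J
    proof -
      interpret J: left_module D "cech_loc scale fs J" by (rule left_module_cech_loc)
      have T: "T J c \<in> J \<rightarrow> carrier (cech_loc scale fs J)" "T J c' \<in> J \<rightarrow> carrier (cech_loc scale fs J)"
        using T_closed[OF J] c by auto
      show ?thesis
        unfolding J.M.finsum_addf[OF T, symmetric]
        by (rule J.M.finsum_cong') (use T T_add[OF J _ c] in \<open>auto intro!: J.M.a_closed\<close>)
    qed
    then show ?thesis
      unfolding diff by (simp add: C'_def cech_module_def cong: restrict_cong)
  qed
  show "cech_diff scale fs i (\<delta> \<odot>\<^bsub>C\<^esub> c) = \<delta> \<odot>\<^bsub>C'\<^esub> cech_diff scale fs i c"
    if \<delta>: "\<delta> \<in> carrier D" and c: "c \<in> carrier C" for \<delta> c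
  proof -
    have "(\<Oplus>\<^bsub>cech_loc scale fs J\<^esub>k\<in>J. T J (\<delta> \<odot>\<^bsub>C\<^esub> c) k)
        = \<delta> \<odot>\<^bsub>cech_loc scale fs J\<^esub> (\<Oplus>\<^bsub>cech_loc scale fs J\<^esub>k\<in>J. T J c k)"
      if J: "J \<in> cech_index fs (Suc i)" for J
    proof -
      interpret J: left_module D "cech_loc scale fs J" by (rule left_module_cech_loc)
      have T: "T J c k \<in> carrier (cech_loc scale fs J)" if "k \<in> J" for k
        using T_closed[OF J that c c] .
      have "(\<Oplus>\<^bsub>cech_loc scale fs J\<^esub>k\<in>J. T J (\<delta> \<odot>\<^bsub>C\<^esub> c) k)
          = (\<Oplus>\<^bsub>cech_loc scale fs J\<^esub>k\<in>J. \<delta> \<odot>\<^bsub>cech_loc scale fs J\<^esub> T J c k)"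
        by (rule J.M.finsum_cong') (use T T_smult[OF J _ c c \<delta>] J.smult_closed[OF \<delta>] in auto)
      also have "\<dots> = \<delta> \<odot>\<^bsub>cech_loc scale fs J\<^esub> (\<Oplus>\<^bsub>cech_loc scale fs J\<^esub>k\<in>J. T J c k)"
        by (rule J.smult_finsum[OF \<delta> fin[OF J] T, symmetric])
      finally show ?thesis .
    qed
    then show ?thesis
      unfolding diff by (simp add: C'_def cech_module_def cong: restrict_cong)
  qed
qed

lemma submodule_cech_cocycles:
  "submodule (cech_cocycles scale fs i) D (cech_module scale fs i)"
  unfolding cech_cocycles_def
  by (intro submodule_kernel_image(1) left_module_cech_module cech_diff_hom)

lemma submodule_cech_coboundaries:
  "submodule (cech_coboundaries scale fs i) D (cech_module scale fs i)"
proof (cases i)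
  case 0
  then show ?thesis by (simp add: zero_submodule[OF left_module_cech_module])
next
  case (Suc j)
  show ?thesis
    unfolding Suc cech_coboundaries.simps
    by (intro submodule_kernel_image(2) left_module_cech_module cech_diff_hom)
qed

end

section \<open>Associated primes\<close>

text \<open>A family \<open>\<C>\<close> closed under unions of chains, such as the submodules of a module or the ideals of
  a ring, satisfies the maximal condition if its members are finitely generated: a chain becomes
  constant once it contains the generators of its union.\<close>

lemma finitely_generated_imp_maximal:
  assumes fg: "\<And>N. N \<in> \<C> \<Longrightarrow> \<exists>S. finite S \<and> S \<subseteq> N \<and> (\<forall>N'\<in>\<C>. S \<subseteq> N' \<longrightarrow> N \<subseteq> N')"
    and union: "\<And>C. C \<noteq> {} \<Longrightarrow> subset.chain \<C> C \<Longrightarrow> \<Union>C \<in> \<C>"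
    and \<S>: "\<S> \<subseteq> \<C>" "\<S> \<noteq> {}"
  shows "\<exists>N\<in>\<S>. \<forall>N'\<in>\<S>. N \<subseteq> N' \<longrightarrow> N' = N"
proof (rule subset_Zorn_nonempty[OF \<S>(2)])
  fix C assume C: "C \<noteq> {}" "subset.chain \<S> C"
  then have C': "subset.chain \<C> C" using \<S>(1) by (auto simp: subset_chain_def)
  obtain S where S: "finite S" "S \<subseteq> \<Union>C" "\<And>N'. N' \<in> \<C> \<Longrightarrow> S \<subseteq> N' \<Longrightarrow> \<Union>C \<subseteq> N'"
    using fg[OF union[OF C(1) C']] by metis
  obtain N where N: "N \<in> C" "S \<subseteq> N"
    using finite_subset_Union_chain[OF S(1,2) C(1) C'] by blast
  then have "N \<in> \<S>" using C(2) by (auto simp: subset_chain_def)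
  moreover have "\<Union>C = N" using S(3)[of N] N \<open>N \<in> \<S>\<close> \<S>(1) by blast
  ultimately show "\<Union>C \<in> \<S>" by simp
qed

text \<open>The associated primes of \<open>M / N\<close>, described without cosets so that \<open>N\<close> can vary inside a
  fixed module.\<close>

definition ass_primes_mod :: "('r::comm_ring_1 \<Rightarrow> 'r, 'b, 'n) module_scheme \<Rightarrow> 'b set \<Rightarrow> 'r set set" where
  "ass_primes_mod M N = {P. primeideal P (ring_of_type_algebra :: 'r ring) \<and>
     (\<exists>m\<in>carrier M. P = {r. (\<lambda>x. r * x) \<odot>\<^bsub>M\<^esub> m \<in> N})}"

text \<open>Closure under \<open>\<delta>\<close> of order \<open>t\<close> is the Ore relation \<open>p\<^sup>k\<^sup>+\<^sup>t \<delta> = \<epsilon> p\<^sup>k\<close>: if \<open>p\<^sup>k\<close> sends \<open>m\<close> into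
  \<open>N\<close>, then \<open>p\<^sup>k\<^sup>+\<^sup>t\<close> sends \<open>\<delta> m\<close> into \<open>N\<close>.\<close>

lemma (in algebra_char_0) torsion_submodule:
  fixes M :: "('r \<Rightarrow> 'r, 'b, 'n) module_scheme" and P :: "'r set"
  assumes "left_module D M" and N: "submodule N D M"
  shows "submodule {m \<in> carrier M. \<forall>p\<in>P. \<exists>k. (\<lambda>x. p ^ k * x) \<odot>\<^bsub>M\<^esub> m \<in> N} D M" (is "submodule ?T D M")
proof -
  interpret left_module D M by fact
  note N' = N[unfolded submodule_iff]
  have comp: "\<delta> \<otimes>\<^bsub>D\<^esub> \<eta> = (\<lambda>x. \<delta> (\<eta> x))" for \<delta> \<eta> by (auto simp: diffop_ring_def)
  note mu = mult_in_diffop[of _ scale]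
  have up: "(\<lambda>x. p ^ (l + k) * x) \<odot>\<^bsub>M\<^esub> m \<in> N"
    if m: "m \<in> carrier M" "(\<lambda>x. p ^ k * x) \<odot>\<^bsub>M\<^esub> m \<in> N" for p l k m
  proof -
    have "(\<lambda>x. p ^ (l + k) * x) = (\<lambda>x. p ^ l * x) \<otimes>\<^bsub>D\<^esub> (\<lambda>x. p ^ k * x)"
      by (simp add: comp power_add mult.assoc)
    then show ?thesis using N' m by (simp add: smult_assoc mu)
  qed
  show ?thesis
    unfolding submodule_iff
  proof (intro conjI ballI)
    show "\<zero>\<^bsub>M\<^esub> \<in> ?T" using N' by (simp add: smult_zero_right[OF mu])
  next
    fix x y assume x: "x \<in> ?T" and y: "y \<in> ?T"
    have "\<exists>k. (\<lambda>z. p ^ k * z) \<odot>\<^bsub>M\<^esub> (x \<oplus>\<^bsub>M\<^esub> y) \<in> N" if p: "p \<in> P" for p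
    proof -
      obtain k l where "(\<lambda>z. p ^ k * z) \<odot>\<^bsub>M\<^esub> x \<in> N" "(\<lambda>z. p ^ l * z) \<odot>\<^bsub>M\<^esub> y \<in> N"
        using x y p by blast
      then have "(\<lambda>z. p ^ (l + k) * z) \<odot>\<^bsub>M\<^esub> x \<in> N" "(\<lambda>z. p ^ (l + k) * z) \<odot>\<^bsub>M\<^esub> y \<in> N"
        using up[of x p k l] up[of y p l k] x y by (simp_all add: add.commute)
      then show ?thesis using N' x y by (intro exI[of _ "l + k"]) (simp add: smult_r_distr[OF mu])
    qed
    then show "x \<oplus>\<^bsub>M\<^esub> y \<in> ?T" using x y by simp
  next
    fix \<delta> x assume \<delta>: "\<delta> \<in> carrier D" and x: "x \<in> ?T"
    obtain t where t: "\<delta> \<in> diffop_le scale t" using \<delta> by (auto simp: in_diffop_iff)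
    have "\<exists>k. (\<lambda>z. p ^ k * z) \<odot>\<^bsub>M\<^esub> (\<delta> \<odot>\<^bsub>M\<^esub> x) \<in> N" if "p \<in> P" for p
    proof -
      obtain k where k: "(\<lambda>z. p ^ k * z) \<odot>\<^bsub>M\<^esub> x \<in> N" using x \<open>p \<in> P\<close> by blast
      let ?\<epsilon> = "conj_op p t \<delta> (- of_nat k)"
      have \<epsilon>: "?\<epsilon> \<in> carrier D" by (rule conj_op_diffop[OF \<delta>])
      have "(\<lambda>z. p ^ (k + t) * z) \<otimes>\<^bsub>D\<^esub> \<delta> = ?\<epsilon> \<otimes>\<^bsub>D\<^esub> (\<lambda>z. p ^ k * z)"
        by (simp add: comp conj_op_of_neg_nat[OF t])
      then have "(\<lambda>z. p ^ (k + t) * z) \<odot>\<^bsub>M\<^esub> (\<delta> \<odot>\<^bsub>M\<^esub> x) = ?\<epsilon> \<odot>\<^bsub>M\<^esub> ((\<lambda>z. p ^ k * z) \<odot>\<^bsub>M\<^esub> x)"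
        using x by (simp add: smult_assoc[symmetric] \<delta> \<epsilon> mu)
      then show ?thesis using N' k \<epsilon> by metis
    qed
    then show "\<delta> \<odot>\<^bsub>M\<^esub> x \<in> ?T" using x \<delta> by (simp add: smult_closed)
  qed auto
qed

text \<open>Let \<open>N\<close> be maximal among the submodules for which \<open>M/N\<close> has infinitely many associated
  primes, \<open>P\<close> a maximal one of these primes, and \<open>T\<close> the preimage in \<open>M\<close> of the
  \<open>P\<close>-torsion of \<open>M/N\<close>. It is larger than \<open>N\<close>, as it contains the element with
  annihilator \<open>P\<close>. An associated prime \<open>Q\<close> of \<open>M/N\<close>,
  say the annihilator of \<open>n\<close>, contains \<open>P\<close>, and then equals it by maximality, or it misses some
  \<open>p \<in> P\<close>. In the second case \<open>r n \<in> T\<close> gives \<open>p\<^sup>k r \<in> Q\<close> and hence \<open>r \<in> Q\<close>, so \<open>Q\<close> is also the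
  annihilator of \<open>n\<close> in \<open>M/T\<close>.\<close>

lemma (in algebra_char_0) finite_ass_primes_mod:
  fixes M :: "('r \<Rightarrow> 'r, 'b, 'n) module_scheme"
  assumes noethD: "left_right_noetherian D" and noeth: "noetherian_left_module D M"
    and N0: "submodule N0 D M"
  shows "finite (ass_primes_mod M N0)"
proof (rule ccontr)
  let ?R = "ring_of_type_algebra :: 'r ring"
  interpret R: cring ?R by (rule cring_from_type_algebra)
  interpret left_module D M using noeth by (simp add: noetherian_left_module_def)
  have R_simps: "carrier ?R = UNIV" "x \<otimes>\<^bsub>?R\<^esub> y = x * y" "\<one>\<^bsub>?R\<^esub> = 1" for x y
    by (simp_all add: ring_of_type_algebra_def)
  note mu = mult_in_diffop[of _ scale]
  have comp: "\<delta> \<otimes>\<^bsub>D\<^esub> \<eta> = (\<lambda>x. \<delta> (\<eta> x))" for \<delta> \<eta> by (auto simp: diffop_ring_def)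
  have one: "(\<lambda>x. 1 * x) \<odot>\<^bsub>M\<^esub> m = m" if "m \<in> carrier M" for m
  proof -
    have "(\<lambda>x. 1 * x) = \<one>\<^bsub>D\<^esub>" by (auto simp: diffop_ring_def)
    then show ?thesis using smult_one[OF that] by metis
  qed
  assume "infinite (ass_primes_mod M N0)"
  have "\<exists>N\<in>{N. submodule N D M \<and> infinite (ass_primes_mod M N)}.
      \<forall>N'\<in>{N. submodule N D M \<and> infinite (ass_primes_mod M N)}. N \<subseteq> N' \<longrightarrow> N' = N"
  proof (rule finitely_generated_imp_maximal[where \<C> = "{N. submodule N D M}"])
    show "\<exists>S. finite S \<and> S \<subseteq> N \<and> (\<forall>N'\<in>{N. submodule N D M}. S \<subseteq> N' \<longrightarrow> N \<subseteq> N')"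
      if "N \<in> {N. submodule N D M}" for N
      unfolding Ball_def mem_Collect_eq
      using noeth[unfolded noetherian_left_module_def, THEN conjunct2, THEN spec, THEN mp,
          OF that[unfolded mem_Collect_eq]] .
    show "\<Union>C \<in> {N. submodule N D M}" if C: "C \<noteq> {}" "subset.chain {N. submodule N D M} C" for C
    proof -
      have sub: "submodule K D M" if "K \<in> C" for K using C(2) that by (auto simp: subset_chain_def)
      have "x \<oplus>\<^bsub>M\<^esub> y \<in> \<Union>C" if xy: "x \<in> \<Union>C" "y \<in> \<Union>C" for x y
      proof -
        obtain K where "K \<in> C" "x \<in> K" "y \<in> K"
          using finite_subset_Union_chain[of "{x, y}", OF _ _ C] xy by auto
        then show ?thesis using sub[of K] unfolding submodule_iff by blast
      qed
      then show ?thesis using C(1) sub unfolding submodule_iff mem_Collect_eq by blast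
    qed
  qed (use N0 \<open>infinite (ass_primes_mod M N0)\<close> in auto)
  then obtain N where N: "submodule N D M" and inf: "infinite (ass_primes_mod M N)"
    and N_max: "\<And>K. submodule K D M \<Longrightarrow> N \<subseteq> K \<Longrightarrow> K \<noteq> N \<Longrightarrow> finite (ass_primes_mod M K)"
    by blast
  note N' = N[unfolded submodule_iff]
  have "\<exists>P\<in>ass_primes_mod M N. \<forall>Q\<in>ass_primes_mod M N. P \<subseteq> Q \<longrightarrow> Q = P"
  proof (rule finitely_generated_imp_maximal[where \<C> = "{I. ideal I ?R}"])
    show "\<exists>S. finite S \<and> S \<subseteq> I \<and> (\<forall>I'\<in>{I. ideal I ?R}. S \<subseteq> I' \<longrightarrow> I \<subseteq> I')"
      if I: "I \<in> {I. ideal I ?R}" for I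
    proof -
      obtain fs where fs: "I = Idl\<^bsub>?R\<^esub> (set fs)"
        using ideal_finitely_generated[OF alg noethD, of I] I by auto
      show ?thesis
        unfolding fs using R.genideal_self[of "set fs"] R.genideal_minimal[of _ "set fs"]
        by (intro exI[of _ "set fs"]) (auto simp: R_simps)
    qed
    show "\<Union>C \<in> {I. ideal I ?R}" if "C \<noteq> {}" "subset.chain {I. ideal I ?R} C" for C
      using R.chain_Union_is_ideal[OF that(2)] that(1) by simp
    show "ass_primes_mod M N \<subseteq> {I. ideal I ?R}"
      by (auto simp: ass_primes_mod_def primeideal.axioms(1))
  qed (use inf in auto)
  then obtain P where P: "P \<in> ass_primes_mod M N"
    and P_max: "\<And>Q. Q \<in> ass_primes_mod M N \<Longrightarrow> P \<subseteq> Q \<Longrightarrow> Q = P" by blast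
  have prime: "1 \<notin> Q" "p ^ k * r \<in> Q \<Longrightarrow> p \<notin> Q \<Longrightarrow> r \<in> Q" if "primeideal Q ?R" for Q p r k
  proof -
    interpret Q: primeideal Q ?R by fact
    show "1 \<notin> Q" using Q.one_imp_carrier Q.I_notcarr by (auto simp: R_simps)
    show "p ^ k * r \<in> Q \<Longrightarrow> p \<notin> Q \<Longrightarrow> r \<in> Q"
    proof (induction k)
      case (Suc k)
      then show ?case using Q.I_prime[of p "p ^ k * r"] by (auto simp: R_simps mult.assoc)
    qed simp
  qed
  obtain m where m: "m \<in> carrier M" "P = {r. (\<lambda>x. r * x) \<odot>\<^bsub>M\<^esub> m \<in> N}" and P_prime: "primeideal P ?R"
    using P by (auto simp: ass_primes_mod_def)
  define T where "T = {m \<in> carrier M. \<forall>p\<in>P. \<exists>k. (\<lambda>x. p ^ k * x) \<odot>\<^bsub>M\<^esub> m \<in> N}"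
  have T: "submodule T D M"
    unfolding T_def by (rule torsion_submodule[OF left_module_axioms N])
  have "N \<subseteq> T"
  proof
    fix x assume x: "x \<in> N"
    have "(\<lambda>z. p ^ 0 * z) \<odot>\<^bsub>M\<^esub> x \<in> N" for p using N' x one[of x] by auto
    then show "x \<in> T" using N' x unfolding T_def by blast
  qed
  moreover have "m \<in> T"
  proof -
    have "(\<lambda>x. p ^ 1 * x) \<odot>\<^bsub>M\<^esub> m \<in> N" if "p \<in> P" for p using that m(2) by simp
    then show ?thesis using m(1) unfolding T_def by blast
  qed
  moreover have "m \<notin> N" using prime(1)[OF P_prime] one[OF m(1)] m(2) by auto
  ultimately have fin: "finite (ass_primes_mod M T)" using N_max[OF T] by blast
  have "ass_primes_mod M N \<subseteq> insert P (ass_primes_mod M T)"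
  proof
    fix Q assume Q: "Q \<in> ass_primes_mod M N"
    then obtain n where n: "n \<in> carrier M" "Q = {r. (\<lambda>x. r * x) \<odot>\<^bsub>M\<^esub> n \<in> N}"
      and Q_prime: "primeideal Q ?R" by (auto simp: ass_primes_mod_def)
    show "Q \<in> insert P (ass_primes_mod M T)"
    proof (cases "P \<subseteq> Q")
      case True
      then show ?thesis using P_max[OF Q] by simp
    next
      case False
      then obtain p where p: "p \<in> P" "p \<notin> Q" by blast
      have "r \<in> Q" if r: "(\<lambda>x. r * x) \<odot>\<^bsub>M\<^esub> n \<in> T" for r
      proof -
        obtain k where k: "(\<lambda>x. p ^ k * x) \<odot>\<^bsub>M\<^esub> ((\<lambda>x. r * x) \<odot>\<^bsub>M\<^esub> n) \<in> N"
          using r p(1) unfolding T_def by blast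
        have "(\<lambda>x. p ^ k * r * x) = (\<lambda>x. p ^ k * x) \<otimes>\<^bsub>D\<^esub> (\<lambda>x. r * x)"
          by (simp add: comp mult.assoc)
        then have "p ^ k * r \<in> Q" using k n by (simp add: smult_assoc[OF mu mu])
        then show ?thesis by (rule prime(2)[OF Q_prime _ p(2)])
      qed
      then have "Q = {r. (\<lambda>x. r * x) \<odot>\<^bsub>M\<^esub> n \<in> T}" using n(2) \<open>N \<subseteq> T\<close> by blast
      then show ?thesis using n(1) Q_prime by (auto simp: ass_primes_mod_def)
    qed
  qed
  then show False using fin inf finite_subset by blast
qed

section \<open>Finiteness of local cohomology\<close>

lemma (in algebra_char_0) ass_primes_subquotient:
  fixes M :: "('r \<Rightarrow> 'r, 'b, 'n) module_scheme"
  assumes M: "left_module D M" and "Z \<subseteq> carrier M" and B: "submodule B D M"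
  shows "ass_primes (subquotient M Z B) \<subseteq> ass_primes_mod M B"
proof
  let ?Q = "subquotient M Z B"
  fix P assume "P \<in> ass_primes ?Q"
  then obtain z where P: "primeideal P (ring_of_type_algebra :: 'r ring)" and z: "z \<in> Z"
    and Pz: "P = {r. (\<lambda>x. r * x) \<odot>\<^bsub>?Q\<^esub> (B +>\<^bsub>M\<^esub> z) = \<zero>\<^bsub>?Q\<^esub>}"
    by (auto simp: ass_primes_def subquotient_carrier[OF M B])
  have zM: "z \<in> carrier M" using z assms(2) by blast
  have "(\<lambda>x. r * x) \<odot>\<^bsub>?Q\<^esub> (B +>\<^bsub>M\<^esub> z) = \<zero>\<^bsub>?Q\<^esub> \<longleftrightarrow> (\<lambda>x. r * x) \<odot>\<^bsub>M\<^esub> z \<in> B" for r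
    unfolding subquotient_smult[OF M B mult_in_diffop zM]
    by (rule subquotient_eq_zero_iff[OF M B left_module.smult_closed[OF M mult_in_diffop zM]])
  then show "P \<in> ass_primes_mod M B"
    using P zM unfolding Pz ass_primes_mod_def by auto
qed

theorem theorem8p6:
  fixes scale :: "'k::field_char_0 \<Rightarrow> 'r::comm_ring_1 \<Rightarrow> 'r"
    and f :: 'r
  assumes "k_algebra scale"
    and "f \<noteq> 0"
    and "has_bernstein_sato scale"
    and "left_right_noetherian (diffop_ring scale)"
  shows "\<forall>\<aa> fs i. ideal \<aa> (ring_of_type_algebra :: 'r ring) \<longrightarrow>
      \<aa> = Idl\<^bsub>(ring_of_type_algebra :: 'r ring)\<^esub> (set fs) \<longrightarrow>
      fin_gen_left_module (diffop_ring scale) (local_cohomology scale fs i) \<and>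
      finite (ass_primes (local_cohomology scale fs i))"
proof (intro allI impI)
  fix fs :: "'r list" and i
  interpret algebra_char_0 scale by unfold_locales (rule assms(1))
  let ?C = "cech_module scale fs i"
  have noeth: "noetherian_left_module D ?C" by (rule noetherian_cech_module[OF assms(3,4)])
  note lm = left_module_cech_module[of fs i]
  note sub = submodule_cech_cocycles[of fs i] submodule_cech_coboundaries[of fs i]
  have "cech_cocycles scale fs i \<subseteq> carrier ?C"
    using sub(1) unfolding left_module.submodule_iff[OF lm] by blast
  then have "ass_primes (local_cohomology scale fs i)
      \<subseteq> ass_primes_mod ?C (cech_coboundaries scale fs i)"
    unfolding local_cohomology_def by (rule ass_primes_subquotient[OF lm _ sub(2)])
  then have "finite (ass_primes (local_cohomology scale fs i))"
    using finite_ass_primes_mod[OF assms(4) noeth sub(2)] by (rule finite_subset)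
  moreover have "fin_gen_left_module D (local_cohomology scale fs i)"
    unfolding local_cohomology_def by (rule fin_gen_subquotient[OF noeth sub])
  ultimately show "fin_gen_left_module D (local_cohomology scale fs i) \<and>
      finite (ass_primes (local_cohomology scale fs i))" by blast
qed

end
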